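(* Let $k\ge 3$ and $1\le j \le k-1$ be integers. Let $\omega=\omega(n)>0$ be a real function satisfying $\omega\to\infty$ and $\omega=o(\log n)$. (i) If $p=\frac{j\log n - \omega}{\binom{n}{k-j}}$, then with probability tending to $1$ as $n\to\infty$, $\mathcal{H}^k(n,p)$ contains isolated $j$-sets (and is therefore not $j$-connected). (ii) If $p=\frac{j\log n + \omega}{\binom{n}{k-j}}$, then with probability tending to $1$ as $n\to\infty$, $\mathcal{H}^k(n,p)$ is $j$-connected (and therefore contains no isolated $j$-sets).
   Context: $\mathcal{H}^k(n,p)$ denotes the binomial random $k$-uniform hypergraph on vertex set $[n]=\{1,\dots,n\}$ in which each $k$-set is an edge independently with probability $p$. A $j$-set is a set of $j$ distinct vertices; it is isolated if it is contained in no edge. Two $j$-sets $J,J'$ are $j$-connected if there is a sequence of edges $e_1,\dots,e_m$ with $J\subset e_1$, $J'\subset e_m$ and $|e_i\cap e_{i+1}|\ge j$ for all $1\le i\le m-1$. The hypergraph is $j$-connected if every two $j$-sets are $j$-connected. *)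

theory Defs
  imports "HOL-Probability.Probability" "HOL-Probability.Product_PMF"
    "HOL-Library.Ramsey" "HOL-Library.Landau_Symbols"
begin

text \<open>A \<open>k\<close>-uniform hypergraph on \<open>{1..n}\<close> is represented by its set of edges, a subset of
  \<^term>\<open>nsets {1..n} k\<close>. Outside \<open>[0, 1]\<close> the parameter \<open>p\<close> is truncated by
  \<^const>\<open>bernoulli_pmf\<close>.\<close>

definition random_hypergraph :: "nat \<Rightarrow> nat \<Rightarrow> real \<Rightarrow> nat set set pmf" where
  "random_hypergraph k n p =
     map_pmf (\<lambda>f. {e \<in> nsets {1..n} k. f e})
       (Pi_pmf (nsets {1..n} k) False (\<lambda>_. bernoulli_pmf p))"

definition isolated_set :: "'a set set \<Rightarrow> 'a set \<Rightarrow> bool" where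
  "isolated_set H J \<longleftrightarrow> \<not> (\<exists>e\<in>H. J \<subseteq> e)"

definition sets_j_connected :: "nat \<Rightarrow> 'a set set \<Rightarrow> 'a set \<Rightarrow> 'a set \<Rightarrow> bool" where
  "sets_j_connected j H J J' \<longleftrightarrow>
     (\<exists>es. es \<noteq> [] \<and> set es \<subseteq> H \<and> J \<subseteq> hd es \<and> J' \<subseteq> last es \<and>
        (\<forall>i. Suc i < length es \<longrightarrow> j \<le> card (es ! i \<inter> es ! Suc i)))"

definition contains_isolated :: "nat \<Rightarrow> 'a set \<Rightarrow> 'a set set \<Rightarrow> bool" where
  "contains_isolated j V H \<longleftrightarrow> (\<exists>J\<in>nsets V j. isolated_set H J)"

text \<open>Only pairs of distinct \<open>j\<close>-sets are required to be connected; the case \<open>J = J'\<close> could matter only if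
  \<open>V\<close> has at most one \<open>j\<close>-subset.\<close>

definition hypergraph_j_connected :: "nat \<Rightarrow> 'a set \<Rightarrow> 'a set set \<Rightarrow> bool" where
  "hypergraph_j_connected j V H \<longleftrightarrow>
     (\<forall>J\<in>nsets V j. \<forall>J'\<in>nsets V j. J \<noteq> J' \<longrightarrow> sets_j_connected j H J J')"

end

theory Submission
  imports Defs "HOL-Combinatorics.Multiset_Permutations" "HOL-Real_Asymp.Real_Asymp"
begin

text \<open>Part (i) is the second moment method: two distinct \<open>j\<close>-sets lie together in so few \<open>k\<close>-sets that
  their isolation events are asymptotically independent, and the expected number of isolated
  \<open>j\<close>-sets is of order \<open>exp \<omega>\<close>.

  For part (ii), if the hypergraph \<open>H\<close> is not \<open>j\<close>-connected, then some component \<open>S\<close> of \<open>j\<close>-sets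
  contains at most half of all \<open>j\<close>-sets. Singleton components are handled by the first moment. For
  larger ones we avoid enumerating spanning trees: keeping each edge with probability \<open>q\<close> retains a
  set of fewer than \<open>card S\<close> edges spanning \<open>S\<close> with probability at least \<open>q ^ card S\<close>, whereas the
  empty boundary of \<open>S\<close> becomes exponentially more likely. Hence the probability that \<open>S\<close> is the
  component of a given \<open>j\<close>-set at density \<open>p\<close> is at most
  \<open>(1 / q) ^ card S * ((1 - p) / (1 - p * q)) ^ b\<close> times the same probability at density \<open>p * q\<close>,
  with \<open>b\<close> the size of the boundary, and the latter probabilities sum to at most \<open>1\<close> over all \<open>S\<close>.
  The boundary is at least linear in \<open>card S\<close>, and asymptotically the sum of all degrees when
  \<open>card S\<close> is bounded, which makes the factor \<open>o(n ^ (- j))\<close> uniformly in \<open>S\<close>.\<close>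

subsection \<open>Binomial random subsets\<close>

text \<open>The probability that a random subset of \<open>E\<close> of density \<open>p\<close>
  lies in \<open>A\<close>, as a finite sum. The ground set is an argument because later steps
  replace \<open>E\<close> by \<open>E - F\<close>, or by a subset \<open>H\<close> that is itself
  thinned.\<close>

definition binweight :: "real \<Rightarrow> 'a set \<Rightarrow> 'a set set \<Rightarrow> real" where
  "binweight p E A = (\<Sum>H\<in>Pow E \<inter> A. p ^ card H * (1 - p) ^ card (E - H))"

lemma prob_random_hypergraph:
  assumes "0 \<le> p" "p \<le> 1"
  shows "measure_pmf.prob (random_hypergraph k n p) A = binweight p (nsets {1..n} k) A"
proof -
  define E where "E = nsets {1..n} k"
  have fin: "finite E" by (simp add: E_def finite_imp_finite_nsets)
  let ?P = "Pi_pmf E False (\<lambda>_. bernoulli_pmf p)"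
  let ?h = "\<lambda>f. {e \<in> E. f e}"
  have pmfH: "pmf (map_pmf ?h ?P) H = p ^ card H * (1 - p) ^ card (E - H)" if H: "H \<subseteq> E" for H
  proof -
    define f where "f = (\<lambda>e. e \<in> H)"
    have "pmf (map_pmf ?h ?P) H = measure_pmf.prob ?P (?h -` {H})"
      by (simp add: pmf_map)
    \<comment> \<open>Almost surely the function is \<open>False\<close> outside \<open>E\<close>,
      so up to a null set the preimage of \<open>{H}\<close> consists of the indicator function
      \<open>f\<close> alone.\<close>
    also have "\<dots> = measure_pmf.prob ?P {f}"
    proof (rule measure_pmf.finite_measure_eq_AE)
      show "AE x in measure_pmf ?P. (x \<in> ?h -` {H}) = (x \<in> {f})"
        using H set_Pi_pmf_subset[OF fin, of False "\<lambda>_. bernoulli_pmf p"]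
        by (auto simp: AE_measure_pmf_iff f_def fun_eq_iff)
    qed auto
    also have "\<dots> = (\<Prod>x\<in>E. pmf (bernoulli_pmf p) (f x))"
      using H by (auto simp: measure_pmf_single pmf_Pi[OF fin] f_def)
    also have "\<dots> = (\<Prod>x\<in>H. pmf (bernoulli_pmf p) (f x)) * (\<Prod>x\<in>E - H. pmf (bernoulli_pmf p) (f x))"
      using H fin by (metis mult.commute prod.subset_diff)
    also have "(\<Prod>x\<in>H. pmf (bernoulli_pmf p) (f x)) = p ^ card H"
      using assms by (simp add: f_def)
    also have "(\<Prod>x\<in>E - H. pmf (bernoulli_pmf p) (f x)) = (1 - p) ^ card (E - H)"
      using assms by (simp add: f_def)
    finally show ?thesis .
  qed
  have "measure_pmf.prob (random_hypergraph k n p) A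
      = measure_pmf.prob (map_pmf ?h ?P) (Pow E \<inter> A)"
    unfolding random_hypergraph_def E_def[symmetric]
    by (rule measure_pmf.finite_measure_eq_AE) (auto simp: AE_measure_pmf_iff)
  also have "\<dots> = (\<Sum>H\<in>Pow E \<inter> A. pmf (map_pmf ?h ?P) H)"
    by (rule measure_measure_pmf_finite) (use fin in auto)
  also have "\<dots> = binweight p E A"
    unfolding binweight_def by (intro sum.cong) (auto simp: pmfH)
  finally show ?thesis unfolding E_def .
qed

lemma sum_Pow_power:
  fixes x y :: real
  assumes "finite E"
  shows "(\<Sum>H\<in>Pow E. x ^ card H * y ^ card (E - H)) = (x + y) ^ card E"
  using prod_add[OF assms, of "\<lambda>_. x" "\<lambda>_. y"] by simp

lemma binweight_UNIV [simp]: "finite E \<Longrightarrow> binweight p E UNIV = 1"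
  using sum_Pow_power[of E p "1 - p"] by (simp add: binweight_def)

lemma binweight_nonneg: "0 \<le> p \<Longrightarrow> p \<le> 1 \<Longrightarrow> 0 \<le> binweight p E A"
  unfolding binweight_def by (intro sum_nonneg) auto

lemma binweight_mono:
  assumes "finite E" "0 \<le> p" "p \<le> 1" "\<And>H. H \<subseteq> E \<Longrightarrow> H \<in> A \<Longrightarrow> H \<in> B"
  shows "binweight p E A \<le> binweight p E B"
  unfolding binweight_def by (rule sum_mono2) (use assms in auto)

lemma binweight_cong:
  assumes "\<And>H. H \<subseteq> E \<Longrightarrow> H \<in> A \<longleftrightarrow> H \<in> B"
  shows "binweight p E A = binweight p E B"
  unfolding binweight_def using assms by (intro sum.cong) auto

lemma binweight_Compl:
  assumes "finite E"
  shows "binweight p E (- A) = 1 - binweight p E A"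
proof -
  have "Pow E \<inter> UNIV = (Pow E \<inter> A) \<union> (Pow E \<inter> - A)" by auto
  hence "binweight p E UNIV = binweight p E A + binweight p E (- A)"
    unfolding binweight_def using assms by (simp only:) (subst sum.union_disjoint, auto)
  thus ?thesis using assms by simp
qed

lemma binweight_UN_le:
  assumes "finite E" "0 \<le> p" "p \<le> 1" "finite I"
  shows "binweight p E (\<Union>i\<in>I. A i) \<le> (\<Sum>i\<in>I. binweight p E (A i))"
  using assms(4)
proof (induction I rule: finite_induct)
  case empty
  then show ?case by (simp add: binweight_def)
next
  case (insert i I)
  let ?w = "\<lambda>H. p ^ card H * (1 - p) ^ card (E - H)"
  let ?X = "Pow E \<inter> A i" and ?Y = "Pow E \<inter> (\<Union>i\<in>I. A i)"
  have "binweight p E (\<Union>i\<in>insert i I. A i) = sum ?w (?X \<union> ?Y)"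
    unfolding binweight_def by (intro sum.cong) auto
  also have "\<dots> = sum ?w ?X + sum ?w ?Y - sum ?w (?X \<inter> ?Y)"
    by (rule sum_Un) (use assms in auto)
  also have "\<dots> \<le> sum ?w ?X + sum ?w ?Y"
    using assms by (simp add: sum_nonneg)
  finally show ?case using insert by (simp add: binweight_def)
qed

lemma binweight_UN_disjoint:
  assumes "finite E" "finite I" "disjoint_family_on A I"
  shows "binweight p E (\<Union>i\<in>I. A i) = (\<Sum>i\<in>I. binweight p E (A i))"
proof -
  let ?w = "\<lambda>H. p ^ card H * (1 - p) ^ card (E - H)"
  have "sum ?w (\<Union>i\<in>I. Pow E \<inter> A i) = (\<Sum>i\<in>I. sum ?w (Pow E \<inter> A i))"
    by (rule sum.UNION_disjoint) (use assms in \<open>auto simp: disjoint_family_on_def\<close>)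
  thus ?thesis unfolding binweight_def by simp
qed

text \<open>The elements of \<open>F\<close> are independent of the rest: each is absent with
  probability \<open>1 - p\<close>, and what remains is a random subset of
  \<open>E - F\<close>.\<close>

lemma binweight_disjnt:
  assumes "finite E" "F \<subseteq> E"
  shows "binweight p E {H \<in> A. H \<inter> F = {}} = (1 - p) ^ card F * binweight p (E - F) A"
proof -
  have "card (E - H) = card F + card (E - F - H)" if "H \<subseteq> E - F" for H
  proof -
    have "E - H = F \<union> (E - F - H)" using that assms by auto
    then show ?thesis using assms
      by (metis Diff_disjoint Int_Diff card_Un_disjoint empty_Diff finite_Diff finite_subset)
  qed
  moreover have "Pow E \<inter> {H \<in> A. H \<inter> F = {}} = Pow (E - F) \<inter> A" by auto
  ultimately show ?thesis unfolding binweight_def sum_distrib_left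
    by (intro sum.cong) (auto simp: power_add)
qed

section \<open>Thinning a random subset\<close>

lemma sum_supersets:
  assumes "G \<subseteq> E"
  shows "(\<Sum>H | G \<subseteq> H \<and> H \<subseteq> E. f H) = (\<Sum>X\<in>Pow (E - G). f (G \<union> X))"
  by (rule sum.reindex_bij_witness[of _ "\<lambda>X. G \<union> X" "\<lambda>H. H - G"])
     (use assms in \<open>auto simp: Un_absorb1\<close>)

lemma binweight_superset:
  assumes "finite E" "F \<subseteq> E"
  shows "binweight q E {G. F \<subseteq> G} = q ^ card F"
proof -
  have fin: "finite F" using assms finite_subset by auto
  have "binweight q E {G. F \<subseteq> G} = (\<Sum>H | F \<subseteq> H \<and> H \<subseteq> E. q ^ card H * (1 - q) ^ card (E - H))"
    unfolding binweight_def by (intro sum.cong) auto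
  also have "\<dots> = (\<Sum>X\<in>Pow (E - F). q ^ card (F \<union> X) * (1 - q) ^ card (E - (F \<union> X)))"
    by (rule sum_supersets[OF assms(2)])
  also have "\<dots> = (\<Sum>X\<in>Pow (E - F). q ^ card F * (q ^ card X * (1 - q) ^ card (E - F - X)))"
  proof (rule sum.cong)
    fix X assume "X \<in> Pow (E - F)"
    hence "card (F \<union> X) = card F + card X"
      using fin assms by (intro card_Un_disjoint) (auto intro: finite_subset)
    moreover have "E - (F \<union> X) = E - F - X" by auto
    ultimately show "q ^ card (F \<union> X) * (1 - q) ^ card (E - (F \<union> X)) =
        q ^ card F * (q ^ card X * (1 - q) ^ card (E - F - X))"
      by (simp add: power_add)
  qed simp
  also have "\<dots> = q ^ card F"
    using sum_Pow_power[of "E - F" q "1 - q"] assms by (simp flip: sum_distrib_left)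
  finally show ?thesis .
qed

text \<open>Two-stage exposure: choosing \<open>H\<close> with density \<open>p\<close> and then
  keeping each element of \<open>H\<close> with probability \<open>q\<close> produces a random set
  of density \<open>p * q\<close>.\<close>

lemma binweight_thinning:
  assumes "finite E"
  shows "binweight (p * q) E A =
    (\<Sum>H\<in>Pow E. p ^ card H * (1 - p) ^ card (E - H) * binweight q H A)"
proof -
  let ?w = "\<lambda>G H. p ^ card H * (1 - p) ^ card (E - H) * (q ^ card G * (1 - q) ^ card (H - G))"
  \<comment> \<open>For fixed \<open>G\<close>, an element of \<open>E - G\<close> is either in
    \<open>H\<close> and then dropped, with weight \<open>p * (1 - q)\<close>, or not in
    \<open>H\<close>, with weight \<open>1 - p\<close>; these add up to
    \<open>1 - p * q\<close>.\<close>
  have *: "(\<Sum>H | G \<subseteq> H \<and> H \<subseteq> E. ?w G H) = (p * q) ^ card G * (1 - p * q) ^ card (E - G)"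
    if G: "G \<subseteq> E" for G
  proof -
    have fin: "finite G" using assms G finite_subset by auto
    have "(\<Sum>H | G \<subseteq> H \<and> H \<subseteq> E. ?w G H) = (\<Sum>X\<in>Pow (E - G). ?w G (G \<union> X))"
      by (rule sum_supersets[OF G])
    also have "\<dots> = (\<Sum>X\<in>Pow (E - G). (p * q) ^ card G *
        ((p * (1 - q)) ^ card X * (1 - p) ^ card (E - G - X)))"
    proof (rule sum.cong)
      fix X assume X: "X \<in> Pow (E - G)"
      hence "card (G \<union> X) = card G + card X"
        using fin assms by (intro card_Un_disjoint) (auto intro: finite_subset)
      moreover have "E - (G \<union> X) = E - G - X" "G \<union> X - G = X" using X by auto
      ultimately show "?w G (G \<union> X) = (p * q) ^ card G *
          ((p * (1 - q)) ^ card X * (1 - p) ^ card (E - G - X))"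
        by (simp add: power_add power_mult_distrib)
    qed simp
    also have "\<dots> = (p * q) ^ card G * (p * (1 - q) + (1 - p)) ^ card (E - G)"
      using sum_Pow_power[of "E - G" "p * (1 - q)" "1 - p"] assms by (simp flip: sum_distrib_left)
    also have "p * (1 - q) + (1 - p) = 1 - p * q" by (simp add: algebra_simps)
    finally show ?thesis .
  qed
  have "binweight (p * q) E A = (\<Sum>G\<in>Pow E \<inter> A. \<Sum>H | H \<in> Pow E \<and> G \<subseteq> H. ?w G H)"
    unfolding binweight_def using * by (intro sum.cong) (auto simp: conj_commute)
  also have "\<dots> = (\<Sum>H\<in>Pow E. \<Sum>G | G \<in> Pow E \<inter> A \<and> G \<subseteq> H. ?w G H)"
    by (rule sum.swap_restrict) (use assms in auto)
  also have "\<dots> = (\<Sum>H\<in>Pow E. p ^ card H * (1 - p) ^ card (E - H) * binweight q H A)"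
    unfolding binweight_def sum_distrib_left
    by (intro sum.cong) auto
  finally show ?thesis .
qed

text \<open>Thinning a member \<open>H\<close> of \<open>A\<close> keeps its whole core
  \<open>F\<close> with probability at least \<open>q ^ r\<close>, and then the thinned set is still
  in \<open>A\<close>.\<close>

lemma binweight_le_thinned:
  assumes fin: "finite E" and p: "0 \<le> p" "p \<le> 1" and q: "0 < q" "q \<le> 1"
    and core: "\<And>H. H \<in> A \<Longrightarrow> H \<subseteq> E \<Longrightarrow>
      \<exists>F\<subseteq>H. card F \<le> r \<and> (\<forall>G. F \<subseteq> G \<longrightarrow> G \<subseteq> H \<longrightarrow> G \<in> A)"
  shows "q ^ r * binweight p E A \<le> binweight (p * q) E A"
proof -
  let ?w = "\<lambda>H. p ^ card H * (1 - p) ^ card (E - H)"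
  have "q ^ r \<le> binweight q H A" if H: "H \<in> A" "H \<subseteq> E" for H
  proof -
    obtain F where F: "F \<subseteq> H" "card F \<le> r" "\<And>G. F \<subseteq> G \<Longrightarrow> G \<subseteq> H \<Longrightarrow> G \<in> A"
      using core[OF H] by blast
    have finH: "finite H" using H fin finite_subset by auto
    have "q ^ r \<le> q ^ card F" using F q by (intro power_decreasing) auto
    also have "\<dots> = binweight q H {G. F \<subseteq> G}" by (rule binweight_superset[symmetric, OF finH F(1)])
    also have "\<dots> \<le> binweight q H A" using F q finH by (intro binweight_mono) auto
    finally show ?thesis .
  qed
  hence "(\<Sum>H\<in>Pow E \<inter> A. ?w H * q ^ r) \<le> (\<Sum>H\<in>Pow E \<inter> A. ?w H * binweight q H A)"
    using p by (intro sum_mono mult_left_mono) auto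
  also have "\<dots> \<le> (\<Sum>H\<in>Pow E. ?w H * binweight q H A)"
    using p q fin by (intro sum_mono2) (auto intro!: mult_nonneg_nonneg binweight_nonneg)
  also have "\<dots> = binweight (p * q) E A" by (rule binweight_thinning[OF fin, symmetric])
  finally show ?thesis unfolding binweight_def by (simp add: sum_distrib_left mult_ac)
qed

subsection \<open>Components of \<open>j\<close>-sets\<close>

definition share_edge :: "nat \<Rightarrow> 'a set set \<Rightarrow> 'a set rel" where
  "share_edge j H = {(J, J'). \<exists>e\<in>H. J \<in> nsets e j \<and> J' \<in> nsets e j}"

text \<open>The closure is reflexive, so a \<open>j\<close>-set belongs to its component even when
  no edge contains it; an isolated \<open>J\<close> has component \<open>{J}\<close>.\<close>

definition jcomp :: "nat \<Rightarrow> 'a set set \<Rightarrow> 'a set \<Rightarrow> 'a set set" where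
  "jcomp j H J = (share_edge j H)\<^sup>* `` {J}"

definition jboundary :: "nat \<Rightarrow> 'a set set \<Rightarrow> 'a set set \<Rightarrow> 'a set set" where
  "jboundary j E S = {e \<in> E. (\<exists>J\<in>nsets e j. J \<in> S) \<and> (\<exists>J\<in>nsets e j. J \<notin> S)}"

lemma share_edge_mono: "F \<subseteq> H \<Longrightarrow> share_edge j F \<subseteq> share_edge j H"
  by (auto simp: share_edge_def)

lemma jcomp_mono: "F \<subseteq> H \<Longrightarrow> jcomp j F J \<subseteq> jcomp j H J"
  unfolding jcomp_def by (intro Image_mono rtrancl_mono share_edge_mono) auto

lemma jcomp_refl: "J \<in> jcomp j H J"
  by (simp add: jcomp_def)

lemma jcomp_step: "I \<in> jcomp j H J \<Longrightarrow> (I, I') \<in> share_edge j H \<Longrightarrow> I' \<in> jcomp j H J"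
  unfolding jcomp_def by (simp add: rtrancl.rtrancl_into_rtrancl)

lemma jcomp_subset_closed:
  assumes "J \<in> S" "\<And>I I'. I \<in> S \<Longrightarrow> (I, I') \<in> share_edge j H \<Longrightarrow> I' \<in> S"
  shows "jcomp j H J \<subseteq> S"
proof
  fix I assume "I \<in> jcomp j H J"
  hence "(J, I) \<in> (share_edge j H)\<^sup>*" by (simp add: jcomp_def)
  thus "I \<in> S" by induction (use assms in auto)
qed

lemma jcomp_subset_nsets:
  assumes "H \<subseteq> nsets V k" "J \<in> nsets V j"
  shows "jcomp j H J \<subseteq> nsets V j"
proof (rule jcomp_subset_closed)
  fix I I' assume "(I, I') \<in> share_edge j H"
  then obtain e where "e \<in> H" "I' \<in> nsets e j" by (auto simp: share_edge_def)
  moreover have "e \<subseteq> V" using \<open>e \<in> H\<close> assms(1) by (auto simp: nsets_def)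
  ultimately show "I' \<in> nsets V j" using nsets_mono by blast
qed (rule assms(2))

lemma jcomp_disjoint_boundary:
  assumes "jcomp j H J = S"
  shows "H \<inter> jboundary j E S = {}"
proof -
  have "I' \<in> S" if "e \<in> H" "I \<in> nsets e j" "I \<in> S" "I' \<in> nsets e j" for e I I'
    using jcomp_step[of I j H J I'] that assms by (auto simp: share_edge_def)
  thus ?thesis unfolding jboundary_def by blast
qed

text \<open>With the boundary avoided, \<open>S\<close> is closed under
  \<open>share_edge j H\<close>, so the extra edges cannot enlarge the component. The component
  event thus survives the addition of edges outside the boundary, as the core hypothesis of
  \<open>binweight_le_thinned\<close> requires.\<close>

lemma jcomp_eq_superset:
  assumes "jcomp j F J = S" "F \<subseteq> H" "H \<subseteq> E" "H \<inter> jboundary j E S = {}"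
  shows "jcomp j H J = S"
proof
  show "S \<subseteq> jcomp j H J" unfolding assms(1)[symmetric] by (rule jcomp_mono[OF assms(2)])
  have "J \<in> S" unfolding assms(1)[symmetric] by (rule jcomp_refl)
  moreover have "I' \<in> S" if "I \<in> S" "(I, I') \<in> share_edge j H" for I I'
    using that assms(3,4) unfolding share_edge_def jboundary_def by blast
  ultimately show "jcomp j H J \<subseteq> S" by (intro jcomp_subset_closed)
qed

text \<open>Each edge of a minimal exploration discovers a new \<open>j\<close>-set.\<close>

lemma jcomp_spanning_edges:
  assumes "finite (jcomp j H J)"
  obtains F where "F \<subseteq> H" "card F < card (jcomp j H J)" "jcomp j F J = jcomp j H J"
proof -
  define P where "P F \<longleftrightarrow> F \<subseteq> H \<and> finite F \<and> card F < card (jcomp j F J)" for F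
  have sub: "jcomp j F J \<subseteq> jcomp j H J" if "F \<subseteq> H" for F using that by (rule jcomp_mono)
  have finF: "finite (jcomp j F J)" if "F \<subseteq> H" for F
    using sub[OF that] assms by (rule finite_subset)
  have "jcomp j {} J \<noteq> {}" using jcomp_refl[of J j "{}"] by blast
  hence "P {}" using finF[of "{}"] by (simp add: P_def card_gt_0_iff)
  moreover have "card (jcomp j F J) < Suc (card (jcomp j H J))" if "P F" for F
    using card_mono[OF assms sub] that by (simp add: less_Suc_eq_le P_def)
  \<comment> \<open>\<open>F\<close> is taken with the largest component among the edge sets that
    have fewer edges than their component has members; the empty set qualifies.\<close>
  ultimately have "\<exists>F. P F \<and> (\<forall>F'. P F' \<longrightarrow> card (jcomp j F' J) \<le> card (jcomp j F J))"
    by (intro ex_has_greatest_nat) auto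
  then obtain F where PF: "P F"
    and max: "\<And>F'. P F' \<Longrightarrow> card (jcomp j F' J) \<le> card (jcomp j F J)" by blast
  have F: "F \<subseteq> H" "finite F" "card F < card (jcomp j F J)" using PF by (auto simp: P_def)
  have "jcomp j H J \<subseteq> jcomp j F J"
  proof (rule jcomp_subset_closed)
    fix I I' assume I: "I \<in> jcomp j F J" and adj: "(I, I') \<in> share_edge j H"
    show "I' \<in> jcomp j F J"
    proof (rule ccontr)
      assume n: "I' \<notin> jcomp j F J"
      obtain e where e: "e \<in> H" "I \<in> nsets e j" "I' \<in> nsets e j"
        using adj by (auto simp: share_edge_def)
      let ?F = "insert e F"
      have s: "jcomp j F J \<subseteq> jcomp j ?F J" by (rule jcomp_mono) auto
      have "(I, I') \<in> share_edge j ?F" using e by (auto simp: share_edge_def)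
      hence "I' \<in> jcomp j ?F J" using s I by (blast intro: jcomp_step)
      hence "jcomp j F J \<subset> jcomp j ?F J" using s n by auto
      \<comment> \<open>The edge \<open>e\<close> adds at least one \<open>j\<close>-set to the
        component, so \<open>P\<close> survives its insertion and the maximality of \<open>F\<close>
        is contradicted.\<close>
      hence lt: "card (jcomp j F J) < card (jcomp j ?F J)"
        using F e by (intro psubset_card_mono finF) auto
      moreover have "P ?F" unfolding P_def using F e lt by (auto simp: card_insert_if)
      ultimately show False using max[of ?F] by simp
    qed
  qed (rule jcomp_refl)
  hence eq: "jcomp j F J = jcomp j H J" using sub F(1) by blast
  show ?thesis by (rule that[of F]) (use F eq in simp_all)
qed

text \<open>Each step of the walk supplies an edge, and consecutive edges overlap in the
  \<open>j\<close>-set at which the walk passes from one to the next. The closure is not reflexive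
  because the edge sequence must be nonempty.\<close>

lemma share_edge_trancl_connected:
  assumes "(J, J') \<in> (share_edge j H)\<^sup>+" "\<And>e. e \<in> H \<Longrightarrow> finite e"
  shows "sets_j_connected j H J J'"
  using assms(1)
proof induction
  case (base I)
  then obtain e where "e \<in> H" "J \<subseteq> e" "I \<subseteq> e" by (auto simp: share_edge_def nsets_def)
  thus ?case unfolding sets_j_connected_def by (intro exI[of _ "[e]"]) auto
next
  case (step I I')
  then obtain e where e: "e \<in> H" "I \<subseteq> e" "I' \<subseteq> e" "card I = j"
    by (auto simp: share_edge_def nsets_def)
  obtain es where es: "es \<noteq> []" "set es \<subseteq> H" "J \<subseteq> hd es" "I \<subseteq> last es"
    "\<And>i. Suc i < length es \<Longrightarrow> j \<le> card (es ! i \<inter> es ! Suc i)"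
    using step.IH unfolding sets_j_connected_def by blast
  have new: "j \<le> card (last es \<inter> e)"
    using e es assms(2)[of e] card_mono[of "last es \<inter> e" I] by auto
  have "j \<le> card ((es @ [e]) ! i \<inter> (es @ [e]) ! Suc i)" if "Suc i < length (es @ [e])" for i
  proof (cases "Suc i < length es")
    case True
    thus ?thesis using es(5) by (simp add: nth_append)
  next
    case False
    hence "i = length es - 1" "Suc i = length es" using that by auto
    thus ?thesis using new es(1) by (simp add: nth_append last_conv_nth)
  qed
  thus ?case unfolding sets_j_connected_def using es e
    by (intro exI[of _ "es @ [e]"]) auto
qed

lemma jcomp_connected:
  assumes "J' \<in> jcomp j H J" "J \<noteq> J'" "\<And>e. e \<in> H \<Longrightarrow> finite e"
  shows "sets_j_connected j H J J'"
  using assms by (intro share_edge_trancl_connected) (auto simp: jcomp_def rtrancl_eq_or_trancl)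

lemma jcomp_disjoint:
  assumes "J' \<notin> jcomp j H J"
  shows "jcomp j H J \<inter> jcomp j H J' = {}"
proof -
  have "sym ((share_edge j H)\<^sup>*)"
    by (intro sym_rtrancl) (auto simp: sym_def share_edge_def)
  hence "(J, J') \<in> (share_edge j H)\<^sup>*"
    if "(J, I) \<in> (share_edge j H)\<^sup>*" "(J', I) \<in> (share_edge j H)\<^sup>*" for I
    using that by (meson symD rtrancl_trans)
  thus ?thesis using assms unfolding jcomp_def by blast
qed

text \<open>An isolated \<open>j\<close>-set is a component by itself; two unconnected
  \<open>j\<close>-sets have disjoint components, and the smaller one holds at most half of all
  \<open>j\<close>-sets. Treating both failures as one event yields both conclusions of part (ii) at
  once.\<close>

lemma small_jcomp_if_not_connected:
  assumes V: "finite V" and H: "H \<subseteq> nsets V k" and j: "1 < card (nsets V j)"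
    and bad: "\<not> hypergraph_j_connected j V H \<or> contains_isolated j V H"
  obtains J where "J \<in> nsets V j" "2 * card (jcomp j H J) \<le> card (nsets V j)"
proof (cases "contains_isolated j V H")
  case True
  then obtain J where J: "J \<in> nsets V j" "isolated_set H J" by (auto simp: contains_isolated_def)
  have "jcomp j H J \<subseteq> {J}"
    by (intro jcomp_subset_closed) (use J in \<open>auto simp: isolated_set_def share_edge_def nsets_def\<close>)
  hence "jcomp j H J = {J}" using jcomp_refl[of J j H] by blast
  thus ?thesis using that[of J] J j by simp
next
  case False
  then obtain J J' where J: "J \<in> nsets V j" "J' \<in> nsets V j" "J \<noteq> J'" "\<not> sets_j_connected j H J J'"
    using bad by (auto simp: hypergraph_j_connected_def)
  have fin: "finite e" if "e \<in> H" for e using that H V by (auto simp: nsets_def)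
  have "J' \<notin> jcomp j H J" using J fin jcomp_connected by blast
  hence "card (jcomp j H J) + card (jcomp j H J') = card (jcomp j H J \<union> jcomp j H J')"
    using finite_subset[OF jcomp_subset_nsets[OF H] finite_imp_finite_nsets[OF V]] J
    by (intro card_Un_disjoint[symmetric] jcomp_disjoint) auto
  also have "\<dots> \<le> card (nsets V j)"
    using jcomp_subset_nsets[OF H] J V by (intro card_mono finite_imp_finite_nsets) auto
  finally have "2 * card (jcomp j H J) \<le> card (nsets V j) \<or> 2 * card (jcomp j H J') \<le> card (nsets V j)"
    by linarith
  thus ?thesis using that J by blast
qed

text \<open>The boundary must be empty at both densities, which contributes a factor
  \<open>1 - p\<close> against \<open>1 - p * q\<close> for each of its edges. The remaining event
  on \<open>E - B\<close> is thinned with the spanning edges of \<open>jcomp_spanning_edges\<close>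
  as core.\<close>

lemma binweight_jcomp_eq_le:
  assumes fin: "finite E" and p: "0 \<le> p" "p \<le> 1" and q: "0 < q" "q < 1" and S: "finite S"
  shows "binweight p E {H. jcomp j H J = S} \<le>
    (1 / q) ^ card S * ((1 - p) / (1 - p * q)) ^ card (jboundary j E S)
      * binweight (p * q) E {H. jcomp j H J = S}"
proof -
  define B where "B = jboundary j E S"
  define A where "A = {H. jcomp j H J = S}"
  have B: "B \<subseteq> E" by (auto simp: B_def jboundary_def)
  have pq: "p * q < 1" using p q mult_right_mono[of p 1 q] by linarith
  \<comment> \<open>The event forces \<open>H\<close> to avoid \<open>B\<close>, so the avoidance
    splits off as an independent factor, at any density \<open>x\<close>.\<close>
  have split: "binweight x E A = (1 - x) ^ card B * binweight x (E - B) A" for x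
  proof -
    have "binweight x E A = binweight x E {H \<in> A. H \<inter> B = {}}"
      unfolding A_def B_def
      by (rule binweight_cong) (use jcomp_disjoint_boundary[of j _ J S E] in blast)
    thus ?thesis using binweight_disjnt[OF fin B] by simp
  qed
  have "q ^ card S * binweight p (E - B) A \<le> binweight (p * q) (E - B) A"
  proof (rule binweight_le_thinned)
    fix H assume H: "H \<in> A" "H \<subseteq> E - B"
    have comp: "jcomp j H J = S" using H(1) by (simp add: A_def)
    have "finite (jcomp j H J)" unfolding comp by (rule S)
    then obtain F where "F \<subseteq> H" "card F < card (jcomp j H J)" "jcomp j F J = jcomp j H J"
      by (rule jcomp_spanning_edges)
    hence F: "F \<subseteq> H" "card F < card S" "jcomp j F J = S" unfolding comp .
    have "G \<in> A" if G: "F \<subseteq> G" "G \<subseteq> H" for G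
    proof -
      have "G \<subseteq> E" "G \<inter> B = {}" using G(2) H(2) by blast+
      hence "jcomp j G J = S"
        using jcomp_eq_superset[OF F(3) G(1)] unfolding B_def by blast
      thus ?thesis by (simp add: A_def)
    qed
    thus "\<exists>F\<subseteq>H. card F \<le> card S \<and> (\<forall>G. F \<subseteq> G \<longrightarrow> G \<subseteq> H \<longrightarrow> G \<in> A)"
      using F(1,2) by (intro exI[of _ F]) simp
  qed (use fin p q in auto)
  hence "binweight p (E - B) A \<le> (1 / q) ^ card S * binweight (p * q) (E - B) A"
    using q by (simp add: power_divide pos_le_divide_eq mult.commute)
  hence "(1 - p) ^ card B * binweight p (E - B) A \<le>
      (1 - p) ^ card B * ((1 / q) ^ card S * binweight (p * q) (E - B) A)"
    using p by (intro mult_left_mono) auto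
  also have "\<dots> = (1 / q) ^ card S * ((1 - p) / (1 - p * q)) ^ card B
      * ((1 - p * q) ^ card B * binweight (p * q) (E - B) A)"
    using pq by (simp add: power_divide)
  finally show ?thesis unfolding split[symmetric] unfolding A_def B_def .
qed

subsection \<open>Boundary expansion\<close>

text \<open>Such an ordering is an ordering of \<open>J\<close>, in \<open>fact a\<close> ways,
  followed by an ordering of \<open>V - J\<close>. The condition \<open>Q\<close> on the tail stays
  general so that a second block can be constrained afterwards.\<close>

lemma card_permutations_split:
  assumes V: "finite V" and J: "J \<in> nsets V a"
  shows "card {xs \<in> permutations_of_set V. set (take a xs) = J \<and> Q (drop a xs)} =
    fact a * card {zs \<in> permutations_of_set (V - J). Q zs}"
proof -
  let ?X = "permutations_of_set J \<times> {zs \<in> permutations_of_set (V - J). Q zs}"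
  let ?Y = "{xs \<in> permutations_of_set V. set (take a xs) = J \<and> Q (drop a xs)}"
  have JV: "J \<subseteq> V" "finite J" "card J = a" using J by (auto simp: nsets_def)
  have len: "length ys = a" if "ys \<in> permutations_of_set J" for ys
    using that JV length_finite_permutations_of_set by blast
  have "bij_betw (\<lambda>(ys, zs). ys @ zs) ?X ?Y"
  proof (rule bij_betw_byWitness[where f' = "\<lambda>xs. (take a xs, drop a xs)"])
    show "(\<lambda>(ys, zs). ys @ zs) ` ?X \<subseteq> ?Y"
      using len JV by (auto simp: permutations_of_set_def)
    show "(\<lambda>xs. (take a xs, drop a xs)) ` ?Y \<subseteq> ?X"
    proof (rule image_subsetI)
      fix xs assume xs: "xs \<in> ?Y"
      have "set (take a xs) \<union> set (drop a xs) = set xs"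
        by (metis append_take_drop_id set_append)
      moreover have "set (take a xs) \<inter> set (drop a xs) = {}"
        using xs by (intro set_take_disj_set_drop_if_distinct) (auto simp: permutations_of_set_def)
      ultimately have "set (drop a xs) = V - J"
        using xs unfolding permutations_of_set_def by blast
      thus "(take a xs, drop a xs) \<in> ?X"
        using xs by (simp add: permutations_of_set_def)
    qed
  qed (simp_all add: len split_beta)
  hence "card ?Y = card ?X" by (rule bij_betw_same_card[symmetric])
  also have "\<dots> = fact a * card {zs \<in> permutations_of_set (V - J). Q zs}"
    using JV by (simp add: card_cartesian_product)
  finally show ?thesis .
qed

lemma card_permutations_prefix:
  assumes V: "finite V" and A: "A \<subseteq> nsets V a"
  shows "card {xs \<in> permutations_of_set V. set (take a xs) \<in> A \<and> Q (drop a xs)} =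
    (\<Sum>J\<in>A. fact a * card {zs \<in> permutations_of_set (V - J). Q zs})"
proof -
  have finA: "finite A" using A V finite_imp_finite_nsets finite_subset by blast
  have "{xs \<in> permutations_of_set V. set (take a xs) \<in> A \<and> Q (drop a xs)} =
      (\<Union>J\<in>A. {xs \<in> permutations_of_set V. set (take a xs) = J \<and> Q (drop a xs)})"
    by auto
  hence "card {xs \<in> permutations_of_set V. set (take a xs) \<in> A \<and> Q (drop a xs)} =
      (\<Sum>J\<in>A. card {xs \<in> permutations_of_set V. set (take a xs) = J \<and> Q (drop a xs)})"
    using finA by (simp only:) (subst card_UN_disjoint, auto)
  also have "\<dots> = (\<Sum>J\<in>A. fact a * card {zs \<in> permutations_of_set (V - J). Q zs})"
    by (intro sum.cong card_permutations_split V) (use A in auto)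
  finally show ?thesis .
qed

lemma card_permutations_prefix_in:
  assumes V: "finite V" and A: "A \<subseteq> nsets V a"
  shows "card {xs \<in> permutations_of_set V. set (take a xs) \<in> A} =
    card A * (fact a * fact (card V - a))"
proof -
  have "card {zs \<in> permutations_of_set (V - J). True} = fact (card V - a)" if "J \<in> A" for J
    using that A V by (auto simp: nsets_def card_Diff_subset)
  thus ?thesis using card_permutations_prefix[OF V A, of "\<lambda>_. True"] by simp
qed

lemma set_take_drop_nsets:
  assumes "xs \<in> permutations_of_set V" "i + a \<le> card V"
  shows "set (take a (drop i xs)) \<in> nsets V a"
proof -
  have xs: "set xs = V" "distinct xs" using assms permutations_of_setD by auto
  hence "length xs = card V" using distinct_card by fastforce
  hence "card (set (take a (drop i xs))) = a"
    using assms(2) xs by (subst distinct_card) auto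
  moreover have "set (take a (drop i xs)) \<subseteq> V"
    using xs by (meson order_trans set_drop_subset set_take_subset)
  ultimately show ?thesis by (auto simp: nsets_def)
qed

text \<open>After the first block \<open>J\<close> is fixed, the second is a \<open>b\<close>-subset
  of \<open>V - J\<close>. The result is only an upper bound because the members of \<open>B\<close>
  that meet \<open>J\<close> are counted as well.\<close>

lemma card_permutations_two_blocks_le:
  assumes V: "finite V" and A: "A \<subseteq> nsets V a" and B: "finite B" and n: "a + b \<le> card V"
  shows "card {xs \<in> permutations_of_set V. set (take a xs) \<in> A \<and> set (take b (drop a xs)) \<in> B}
    \<le> card A * card B * (fact a * fact b * fact (card V - a - b))"
proof -
  have *: "card {zs \<in> permutations_of_set (V - J). set (take b zs) \<in> B}
      \<le> card B * (fact b * fact (card V - a - b))" if J: "J \<in> A" for J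
  proof -
    have cJ: "card (V - J) = card V - a"
      using J A V by (auto simp: nsets_def card_Diff_subset)
    have "{zs \<in> permutations_of_set (V - J). set (take b zs) \<in> B} =
        {zs \<in> permutations_of_set (V - J). set (take b zs) \<in> B \<inter> nsets (V - J) b}"
      using set_take_drop_nsets[of _ "V - J" 0 b] n cJ by auto
    hence "card {zs \<in> permutations_of_set (V - J). set (take b zs) \<in> B} =
        card (B \<inter> nsets (V - J) b) * (fact b * fact (card V - a - b))"
      using card_permutations_prefix_in[of "V - J" "B \<inter> nsets (V - J) b" b] V cJ by simp
    also have "\<dots> \<le> card B * (fact b * fact (card V - a - b))"
      using B by (intro mult_right_mono card_mono) auto
    finally show ?thesis .
  qed
  have "card {xs \<in> permutations_of_set V. set (take a xs) \<in> A \<and> set (take b (drop a xs)) \<in> B} =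
      (\<Sum>J\<in>A. fact a * card {zs \<in> permutations_of_set (V - J). set (take b zs) \<in> B})"
    by (rule card_permutations_prefix[OF V A, of "\<lambda>zs. set (take b zs) \<in> B"])
  also have "\<dots> \<le> (\<Sum>J\<in>A. fact a * (card B * (fact b * fact (card V - a - b))))"
    using * by (intro sum_mono mult_left_mono) auto
  also have "\<dots> = card A * card B * (fact a * fact b * fact (card V - a - b))"
    by (simp add: mult_ac)
  finally show ?thesis .
qed

text \<open>Rotating by \<open>i\<close> moves the window at position \<open>i\<close> to the front,
  so exits at different positions can be compared. The strict bound keeps the next window from
  wrapping around.\<close>

lemma rotate_window:
  assumes "i + a \<le> length xs" "i < length xs"
  shows "take a (rotate i xs) = take a (drop i xs)"
    "i + a < length xs \<Longrightarrow> take a (drop 1 (rotate i xs)) = take a (drop (Suc i) xs)"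
proof -
  have r: "rotate i xs = drop i xs @ take i xs" using assms by (simp add: rotate_drop_take)
  show "take a (rotate i xs) = take a (drop i xs)" using assms by (simp add: r)
  assume "i + a < length xs"
  thus "take a (drop 1 (rotate i xs)) = take a (drop (Suc i) xs)" by (simp add: r)
qed

lemma first_exit:
  fixes P :: "nat \<Rightarrow> bool"
  assumes "P 0" "\<not> P m"
  shows "\<exists>i<m. P i \<and> \<not> P (Suc i)"
  using assms(2)
proof (induction m)
  case (Suc m)
  thus ?case using less_Suc_eq by (cases "P m") auto
qed (use assms in auto)

text \<open>Slide a window of length \<open>j\<close> along a uniformly random ordering of \<open>V\<close>. If its first position is
  a member of \<open>S\<close> and its \<open>j\<close>-th (disjoint) one is not, then one of the \<open>j\<close> unit shifts leaves \<open>S\<close>;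
  by rotation invariance each shift does so at most as often as a random \<open>k\<close>-set lies in the
  boundary of \<open>S\<close>.\<close>

lemma jboundary_window_count:
  assumes V: "finite V" "card V = n" and j: "1 \<le> j" "j < k" and n: "2 * j \<le> n" "k \<le> n"
    and S: "S \<subseteq> nsets V j"
  shows "card S * (fact j * fact (n - j)) \<le>
    card S * card S * (fact j * fact j * fact (n - j - j))
    + j * (card (jboundary j (nsets V k) S) * (fact k * fact (n - k)))"
proof -
  let ?P = "permutations_of_set V"
  define win where "win i xs = set (take j (drop i xs))" for i and xs :: "'a list"
  define W where "W i = {xs \<in> ?P. win i xs \<in> S \<and> win (Suc i) xs \<notin> S}" for i
  let ?B = "jboundary j (nsets V k) S"
  have finS: "finite S" using S V finite_imp_finite_nsets finite_subset by blast
  have finP: "finite ?P" by simp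
  have finW: "finite (W i)" for i using finP by (simp add: W_def)
  have len: "length xs = n" if "xs \<in> ?P" for xs
    using that V length_finite_permutations_of_set by blast
  have W0: "card (W 0) \<le> card ?B * (fact k * fact (n - k))"
  proof -
    \<comment> \<open>The windows at positions 0 and 1 both lie in the first \<open>j + 1\<close>
      entries, and \<open>j < k\<close>, so the first \<open>k\<close> entries form a boundary
      edge.\<close>
    have "W 0 \<subseteq> {xs \<in> ?P. set (take k xs) \<in> ?B}"
    proof
      fix xs assume xs: "xs \<in> W 0"
      hence P: "xs \<in> ?P" by (simp add: W_def)
      have "win i xs \<in> nsets (set (take k xs)) j" if i: "i + j \<le> k" for i
      proof -
        have "take j (drop i xs) = take j (drop i (take k xs))"
          using i by (simp add: drop_take min_def)
        hence "win i xs \<subseteq> set (take k xs)"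
          unfolding win_def by (metis order_trans set_drop_subset set_take_subset)
        moreover have "win i xs \<in> nsets V j"
          unfolding win_def using set_take_drop_nsets[OF P, of i j] i n V by simp
        ultimately show ?thesis by (auto simp: nsets_def)
      qed
      from this[of 0] this[of "Suc 0"] j
      have "win 0 xs \<in> nsets (set (take k xs)) j" "win (Suc 0) xs \<in> nsets (set (take k xs)) j"
        by auto
      moreover have "set (take k xs) \<in> nsets V k"
        using set_take_drop_nsets[OF P, of 0 k] n V by simp
      ultimately have "set (take k xs) \<in> ?B"
        using xs unfolding jboundary_def W_def by blast
      thus "xs \<in> {xs \<in> ?P. set (take k xs) \<in> ?B}" using P by simp
    qed
    hence "card (W 0) \<le> card {xs \<in> ?P. set (take k xs) \<in> ?B}"
      using finP by (intro card_mono) auto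
    also have "\<dots> = card ?B * (fact k * fact (n - k))"
      using card_permutations_prefix_in[OF V(1), of ?B k] V by (auto simp: jboundary_def)
    finally show ?thesis .
  qed
  have Wi: "card (W i) \<le> card (W 0)" if i: "i < j" for i
  proof (rule card_inj_on_le[of "rotate i"])
    show "inj_on (rotate i) (W i)" 
      by (rule inj_on_subset[OF _ subset_UNIV]) (simp add: rotate_def inj_rotate1)
    show "rotate i ` W i \<subseteq> W 0"
    proof safe
      fix xs assume xs: "xs \<in> W i"
      hence l: "length xs = n" using len by (simp add: W_def)
      have "win 0 (rotate i xs) = win i xs" "win (Suc 0) (rotate i xs) = win (Suc i) xs"
        using rotate_window[of i j xs] l i n j by (auto simp: win_def)
      thus "rotate i xs \<in> W 0" using xs by (simp add: W_def permutations_of_set_def)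
    qed
  qed (rule finW)
  have "card S * (fact j * fact (n - j)) = card {xs \<in> ?P. win 0 xs \<in> S}"
    using card_permutations_prefix_in[OF V(1) S] V by (simp add: win_def)
  also have "\<dots> \<le> card ({xs \<in> ?P. win 0 xs \<in> S \<and> win j xs \<in> S} \<union> (\<Union>i<j. W i))"
  proof (rule card_mono)
    show "{xs \<in> ?P. win 0 xs \<in> S} \<subseteq> {xs \<in> ?P. win 0 xs \<in> S \<and> win j xs \<in> S} \<union> (\<Union>i<j. W i)"
      using first_exit[of "\<lambda>i. win i _ \<in> S" j] by (auto simp: W_def)
  qed (use finP finW in auto)
  also have "\<dots> \<le> card {xs \<in> ?P. win 0 xs \<in> S \<and> win j xs \<in> S} + card (\<Union>i<j. W i)"
    by (rule card_Un_le)
  also have "card {xs \<in> ?P. win 0 xs \<in> S \<and> win j xs \<in> S}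
      \<le> card S * card S * (fact j * fact j * fact (n - j - j))"
    using card_permutations_two_blocks_le[OF V(1) S finS, of j] n V by (simp add: win_def)
  also have "card (\<Union>i<j. W i) \<le> (\<Sum>i<j. card (W i))" by (rule card_UN_le) simp
  also have "\<dots> \<le> (\<Sum>i<j. card ?B * (fact k * fact (n - k)))"
    by (intro sum_mono order_trans[OF Wi W0]) auto
  also have "\<dots> = j * (card ?B * (fact k * fact (n - k)))" by simp
  finally show ?thesis by simp
qed

text \<open>Divided by \<open>fact n\<close>, the window count bounds the density of
  \<open>S\<close> among the \<open>j\<close>-sets by a pair term plus \<open>j\<close> times the
  density of the boundary among the \<open>k\<close>-sets. By \<open>small\<close> the pair term is
  at most two thirds of the left side; the third that is left explains the factor 3.\<close>

lemma jboundary_expansion: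
  assumes V: "finite V" "card V = n" and j: "1 \<le> j" "j < k" and n: "2 * j \<le> n" "k \<le> n"
    and S: "S \<subseteq> nsets V j" and small: "3 * card S \<le> 2 * ((n - j) choose j)"
  shows "card S * ((n - j) choose (k - j)) \<le>
    3 * j * (k choose j) * card (jboundary j (nsets V k) S)"
proof -
  define s b where "s = real (card S)" and "b = real (card (jboundary j (nsets V k) S))"
  \<comment> \<open>The numbers of all \<open>j\<close>-sets, of \<open>j\<close>-sets disjoint from
    a given one, and of all \<open>k\<close>-sets.\<close>
  define X Y Z where "X = real (n choose j)" and "Y = real ((n - j) choose j)"
    and "Z = real (n choose k)"
  have pos: "X > 0" "Y > 0" "Z > 0" using n j by (auto simp: X_def Y_def Z_def)
  have f: "fact j * fact (n - j) = fact n / X" "fact j * fact (n - j - j) = fact (n - j) / Y"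
    "fact k * fact (n - k) = fact n / Z"
    using n j by (simp_all add: X_def Y_def Z_def binomial_fact)
  have "real (card S * (fact j * fact (n - j))) \<le>
      real (card S * card S * (fact j * fact j * fact (n - j - j))
      + j * (card (jboundary j (nsets V k) S) * (fact k * fact (n - k))))"
    using jboundary_window_count[OF V j n S] by (simp only: of_nat_le_iff)
  hence "s * (fact j * fact (n - j)) \<le>
      s * s * (fact j * (fact j * fact (n - j - j))) + j * (b * (fact k * fact (n - k)))"
    by (simp add: s_def b_def mult_ac)
  hence "s * (fact n / X) \<le> s * s * (fact j * fact (n - j)) / Y + j * b * (fact n / Z)"
    unfolding f(2,3) by (simp add: f(1))
  hence "fact n * (s / X) \<le> fact n * (s * s / (X * Y) + j * b / Z)"
    unfolding f(1) by (simp add: algebra_simps)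
  hence "s / X \<le> s * s / (X * Y) + j * b / Z"
    by (simp only: mult_le_cancel_left_pos[OF fact_gt_zero])
  moreover have "s * s / (X * Y) \<le> s * (2 / 3) / X"
  proof -
    have "3 * s \<le> 2 * Y" using small unfolding s_def Y_def by linarith
    hence "s / Y \<le> 2 / 3" using pos by (simp add: field_simps)
    hence "s / X * (s / Y) \<le> s / X * (2 / 3)"
      using pos by (intro mult_left_mono) (auto simp: s_def)
    thus ?thesis by simp
  qed
  ultimately have "s / X / 3 \<le> j * b / Z" by simp
  hence 1: "s * Z \<le> 3 * j * b * X" using pos by (simp add: field_simps)
  \<comment> \<open>Counting pairs of a \<open>j\<close>-set inside a \<open>k\<close>-set in two
    ways turns \<open>Z / X\<close> into the common degree of the \<open>j\<close>-sets divided by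
    \<open>k choose j\<close>.\<close>
  have 2: "Z * real (k choose j) = X * real ((n - j) choose (k - j))"
    unfolding X_def Z_def using choose_mult[of j k n] j n by (metis less_imp_le of_nat_mult)
  have "X * (s * real ((n - j) choose (k - j))) = s * Z * real (k choose j)"
    using 2 by (simp add: mult_ac)
  also have "\<dots> \<le> 3 * j * b * X * real (k choose j)"
    using 1 by (intro mult_right_mono) auto
  finally have "X * (s * real ((n - j) choose (k - j))) \<le> X * (3 * j * real (k choose j) * b)"
    by (simp add: mult_ac)
  hence "s * real ((n - j) choose (k - j)) \<le> 3 * j * real (k choose j) * b"
    using pos by simp
  hence "real (card S * ((n - j) choose (k - j))) \<le>
      real (3 * j * (k choose j) * card (jboundary j (nsets V k) S))"
    by (simp add: s_def b_def)
  thus ?thesis by (simp only: of_nat_le_iff)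
qed

section \<open>Degrees and codegrees of \<open>j\<close>-sets\<close>

lemma card_nsets_superset:
  assumes V: "finite V" and J: "J \<subseteq> V" "card J \<le> k"
  shows "card {e \<in> nsets V k. J \<subseteq> e} = (card V - card J) choose (k - card J)"
proof -
  have finJ: "finite J" using V J finite_subset by blast
  have "bij_betw (\<lambda>X. J \<union> X) (nsets (V - J) (k - card J)) {e \<in> nsets V k. J \<subseteq> e}"
  proof (rule bij_betw_byWitness[where f' = "\<lambda>e. e - J"])
    show "(\<lambda>X. J \<union> X) ` nsets (V - J) (k - card J) \<subseteq> {e \<in> nsets V k. J \<subseteq> e}"
    proof safe
      fix X assume X: "X \<in> nsets (V - J) (k - card J)"
      hence "card (J \<union> X) = card J + card X"
        using finJ by (intro card_Un_disjoint) (auto simp: nsets_def)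
      thus "J \<union> X \<in> nsets V k" using X J finJ by (auto simp: nsets_def)
    qed
  qed (use finJ J in \<open>auto simp: nsets_def card_Diff_subset\<close>)
  hence "card {e \<in> nsets V k. J \<subseteq> e} = card (nsets (V - J) (k - card J))"
    by (rule bij_betw_same_card[symmetric])
  thus ?thesis using V J finJ by (simp add: card_Diff_subset)
qed

text \<open>Some vertex of \<open>J'\<close> lies outside \<open>J\<close>, so the edge contains a
  fixed set of \<open>j + 1\<close> vertices. For fixed \<open>j\<close> and \<open>k\<close> this
  is smaller than a degree by a factor of order \<open>n\<close>.\<close>

lemma card_nsets_superset_two_le:
  assumes V: "finite V" and J: "J \<in> nsets V j" "J' \<in> nsets V j" "J \<noteq> J'" and k: "j < k"
  shows "card {e \<in> nsets V k. J \<subseteq> e \<and> J' \<subseteq> e} \<le> (card V - j - 1) choose (k - j - 1)"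
proof -
  have "\<not> J' \<subseteq> J" using J card_subset_eq[of J J'] by (auto simp: nsets_def)
  then obtain x where x: "x \<in> J'" "x \<notin> J" by blast
  have c: "card (insert x J) = Suc j" "insert x J \<subseteq> V" using J x by (auto simp: nsets_def)
  have "card {e \<in> nsets V k. J \<subseteq> e \<and> J' \<subseteq> e} \<le> card {e \<in> nsets V k. insert x J \<subseteq> e}"
    using x V by (intro card_mono) (auto simp: finite_imp_finite_nsets)
  also have "\<dots> = (card V - Suc j) choose (k - Suc j)"
    using card_nsets_superset[OF V c(2), of k] c k by simp
  finally show ?thesis by simp
qed

text \<open>Exchange one element of \<open>J\<close> for an element of \<open>e\<close> outside it.
  Hence an edge with exactly one member of \<open>S\<close> inside it is a boundary edge.\<close>

lemma exists_other_nset: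
  assumes "J \<in> nsets e j" "1 \<le> j" "j < card e"
  shows "\<exists>J'\<in>nsets e j. J' \<noteq> J"
proof -
  have J: "J \<subseteq> e" "finite J" "card J = j" using assms by (auto simp: nsets_def)
  hence "\<not> e \<subseteq> J" using assms card_mono[of J e] by auto
  then obtain y where y: "y \<in> e" "y \<notin> J" by blast
  obtain x where x: "x \<in> J" using J assms by fastforce
  have "card (insert y (J - {x})) = j" using J x y assms by simp
  hence "insert y (J - {x}) \<in> nsets e j" using J y by (auto simp: nsets_def)
  thus ?thesis using y by blast
qed

text \<open>Edges through exactly one member of \<open>S\<close> lie in the boundary and are
  distinct for distinct members. Each member loses at most \<open>card S\<close> codegrees from its
  degree, so for bounded \<open>card S\<close> the boundary is nearly as large as the sum of the
  degrees.\<close>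

lemma jboundary_sparse:
  assumes V: "finite V" "card V = n" and j: "1 \<le> j" "j < k" and S: "S \<subseteq> nsets V j"
  shows "card S * ((n - j) choose (k - j)) \<le> card (jboundary j (nsets V k) S)
    + card S * card S * ((n - j - 1) choose (k - j - 1))"
proof -
  define E where "E J = {e \<in> nsets V k. J \<subseteq> e}" for J
  define T where "T J = E J - (\<Union>J'\<in>S - {J}. E J \<inter> E J')" for J
  let ?M = "(n - j - 1) choose (k - j - 1)" and ?D = "(n - j) choose (k - j)"
  have finS: "finite S" using S V finite_imp_finite_nsets finite_subset by blast
  have finN: "finite (nsets V k)" using V by (simp add: finite_imp_finite_nsets)
  have finE: "finite (E J)" for J using finN by (simp add: E_def)
  have "T J \<subseteq> jboundary j (nsets V k) S" if J: "J \<in> S" for J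
  proof
    fix e assume e: "e \<in> T J"
    have Je: "J \<in> nsets e j" and ce: "card e = k"
      using J e S by (auto simp: T_def E_def nsets_def)
    then obtain J' where J': "J' \<in> nsets e j" "J' \<noteq> J" using exists_other_nset j by blast
    moreover have "e \<in> E J'" "e \<in> E J" using e J' by (auto simp: T_def E_def nsets_def)
    ultimately have "J' \<notin> S" using e unfolding T_def by blast
    thus "e \<in> jboundary j (nsets V k) S"
      using J Je J'(1) e unfolding jboundary_def T_def E_def by blast
  qed
  hence "card (\<Union>J\<in>S. T J) \<le> card (jboundary j (nsets V k) S)"
    using finN by (intro card_mono) (auto simp: jboundary_def)
  moreover have "card (\<Union>J\<in>S. T J) = (\<Sum>J\<in>S. card (T J))"
  proof (rule card_UN_disjoint)
    show "\<forall>i\<in>S. \<forall>l\<in>S. i \<noteq> l \<longrightarrow> T i \<inter> T l = {}" unfolding T_def by blast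
  qed (use finS finE in \<open>auto simp: T_def\<close>)
  moreover have "?D \<le> card (T J) + card S * ?M" if J: "J \<in> S" for J
  proof -
    have JV: "J \<in> nsets V j" using J S by auto
    have "card (\<Union>J'\<in>S - {J}. E J \<inter> E J') \<le> (\<Sum>J'\<in>S - {J}. card (E J \<inter> E J'))"
      using finS by (intro card_UN_le) auto
    also have "\<dots> \<le> (\<Sum>J'\<in>S - {J}. ?M)"
    proof (rule sum_mono)
      fix J' assume J': "J' \<in> S - {J}"
      have "E J \<inter> E J' = {e \<in> nsets V k. J \<subseteq> e \<and> J' \<subseteq> e}" by (auto simp: E_def)
      thus "card (E J \<inter> E J') \<le> ?M"
        using card_nsets_superset_two_le[OF V(1) JV, of J' k] J' S j V by auto
    qed
    also have "\<dots> \<le> card S * ?M" using finS by (simp add: card_Diff1_le)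
    finally have "card (\<Union>J'\<in>S - {J}. E J \<inter> E J') \<le> card S * ?M" .
    moreover have "card (E J) = ?D"
      using card_nsets_superset[OF V(1), of J k] JV j V by (auto simp: E_def nsets_def)
    moreover have "card (E J) - card (\<Union>J'\<in>S - {J}. E J \<inter> E J') \<le> card (T J)"
      unfolding T_def by (rule diff_card_le_card_Diff) (use finS finE in auto)
    ultimately show ?thesis by linarith
  qed
  hence "(\<Sum>J\<in>S. ?D) \<le> (\<Sum>J\<in>S. card (T J) + card S * ?M)" by (intro sum_mono) auto
  ultimately show ?thesis by (simp add: sum.distrib mult_ac)
qed

subsection \<open>Probability bounds\<close>

lemma isolated_set_iff_disjoint:
  assumes "H \<subseteq> E"
  shows "isolated_set H J \<longleftrightarrow> H \<inter> {e \<in> E. J \<subseteq> e} = {}"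
  using assms by (auto simp: isolated_set_def)

lemma binweight_avoid:
  assumes "finite E" "F \<subseteq> E"
  shows "binweight p E {H. H \<inter> F = {}} = (1 - p) ^ card F"
  using binweight_disjnt[OF assms, of p UNIV] assms by simp

text \<open>Chebyshev's inequality for the number of isolated \<open>j\<close>-sets, with mean
  \<open>N * (1 - p) ^ D\<close>: the bound is an estimate of the variance divided by the square of
  the mean.\<close>

lemma binweight_no_isolated_le:
  assumes V: "finite V" "card V = n" and j: "1 \<le> j" "j < k" "j \<le> n" and p: "0 \<le> p" "p < 1"
  defines "D \<equiv> (n - j) choose (k - j)" and "M \<equiv> (n - j - 1) choose (k - j - 1)"
    and "N \<equiv> n choose j"
  shows "binweight p (nsets V k) {H. \<not> contains_isolated j V H} \<le>
    1 / (real N * (1 - p) ^ D) + 1 / (1 - p) ^ M - 1"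
proof -
  define E where "E = nsets V k"
  define JS where "JS = nsets V j"
  define q where "q = 1 - p"
  define F where "F J = {e \<in> E. J \<subseteq> e}" for J
  define w where "w H = p ^ card H * (1 - p) ^ card (E - H)" for H
  define X :: "'a set set \<Rightarrow> real" where "X H = (\<Sum>J\<in>JS. of_bool (isolated_set H J))" for H
  define \<mu> where "\<mu> = real N * q ^ D"
  have q: "0 < q" "q \<le> 1" using p by (auto simp: q_def)
  have fin: "finite E" "finite JS" using V by (auto simp: E_def JS_def finite_imp_finite_nsets)
  have FE: "F J \<subseteq> E" for J by (auto simp: F_def)
  have cN: "card JS = N" using V by (simp add: JS_def N_def)
  have N: "N > 0" using j by (simp add: N_def)
  have \<mu>: "\<mu> > 0" using N q by (simp add: \<mu>_def)
  have cF: "card (F J) = D" if "J \<in> JS" for J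
    using card_nsets_superset[OF V(1), of J k] that j V by (auto simp: F_def E_def JS_def nsets_def D_def)
  have w: "w H \<ge> 0" for H using p by (simp add: w_def)
  have ex: "(\<Sum>H\<in>Pow E. w H * of_bool (H \<in> A)) = binweight p E A" for A
    using fin unfolding binweight_def w_def
    by (simp add: of_bool_def if_distrib sum.inter_restrict cong: if_cong)
  have avoid: "(\<Sum>H\<in>Pow E. w H * of_bool (H \<inter> G = {})) = q ^ card G" if "G \<subseteq> E" for G
    using ex[of "{H. H \<inter> G = {}}"] binweight_avoid[OF fin(1) that] by (simp add: q_def)
  have XF: "X H = (\<Sum>J\<in>JS. of_bool (H \<inter> F J = {}))" if "H \<in> Pow E" for H
    unfolding X_def F_def using that by (intro sum.cong) (auto simp: isolated_set_iff_disjoint)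
  have EX: "(\<Sum>H\<in>Pow E. w H * X H) = \<mu>"
  proof -
    have "(\<Sum>H\<in>Pow E. w H * X H) = (\<Sum>H\<in>Pow E. \<Sum>J\<in>JS. w H * of_bool (H \<inter> F J = {}))"
      by (intro sum.cong refl) (simp add: XF sum_distrib_left)
    also have "\<dots> = (\<Sum>J\<in>JS. \<Sum>H\<in>Pow E. w H * of_bool (H \<inter> F J = {}))" by (rule sum.swap)
    also have "\<dots> = (\<Sum>J\<in>JS. q ^ D)" by (intro sum.cong refl) (simp add: avoid FE cF)
    finally show ?thesis using cN by (simp add: \<mu>_def)
  qed
  have EX2: "(\<Sum>H\<in>Pow E. w H * (X H)\<^sup>2) \<le> \<mu> + \<mu>\<^sup>2 / q ^ M"
  proof -
    \<comment> \<open>Two distinct \<open>j\<close>-sets share at most \<open>M\<close> edges, so at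
      least \<open>2 * D - M\<close> edges must be absent for both to be isolated. The second
      summand is kept for \<open>J = J'\<close> too, so that its sum over all pairs is a
      square.\<close>
    have pair: "q ^ card (F J \<union> F J') \<le> (if J = J' then q ^ D else 0) + q ^ D * q ^ D / q ^ M"
      if J: "J \<in> JS" "J' \<in> JS" for J J'
    proof (cases "J = J'")
      case True
      thus ?thesis using q cF J by simp
    next
      case False
      have "card (F J \<inter> F J') \<le> M"
      proof -
        have "F J \<inter> F J' = {e \<in> nsets V k. J \<subseteq> e \<and> J' \<subseteq> e}" by (auto simp: F_def E_def)
        thus ?thesis using card_nsets_superset_two_le[OF V(1), of J j J' k] J False j V
          by (simp add: JS_def M_def)
      qed
      moreover have "card (F J) + card (F J') = card (F J \<union> F J') + card (F J \<inter> F J')"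
        using fin FE finite_subset by (intro card_Un_Int) blast+
      ultimately have "D + D \<le> card (F J \<union> F J') + M" using cF J by simp
      hence "q ^ (card (F J \<union> F J') + M) \<le> q ^ (D + D)" using q by (intro power_decreasing) auto
      hence "q ^ card (F J \<union> F J') \<le> q ^ D * q ^ D / q ^ M"
        using q by (simp add: power_add pos_le_divide_eq)
      thus ?thesis using False by simp
    qed
    have "w H * (X H)\<^sup>2 = (\<Sum>J\<in>JS. \<Sum>J'\<in>JS. w H * of_bool (H \<inter> (F J \<union> F J') = {}))"
      if "H \<in> Pow E" for H
      unfolding XF[OF that] power2_eq_square sum_product sum_distrib_left
      by (intro sum.cong refl) (simp add: Int_Un_distrib of_bool_conj sum_distrib_left)
    hence "(\<Sum>H\<in>Pow E. w H * (X H)\<^sup>2) =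
        (\<Sum>H\<in>Pow E. \<Sum>J\<in>JS. \<Sum>J'\<in>JS. w H * of_bool (H \<inter> (F J \<union> F J') = {}))"
      by (intro sum.cong refl)
    also have "\<dots> = (\<Sum>J\<in>JS. \<Sum>J'\<in>JS. \<Sum>H\<in>Pow E. w H * of_bool (H \<inter> (F J \<union> F J') = {}))"
      by (subst sum.swap, intro sum.cong refl sum.swap)
    also have "\<dots> = (\<Sum>J\<in>JS. \<Sum>J'\<in>JS. q ^ card (F J \<union> F J'))"
      by (intro sum.cong refl avoid) (use FE in auto)
    also have "\<dots> \<le> (\<Sum>J\<in>JS. \<Sum>J'\<in>JS. (if J = J' then q ^ D else 0) + q ^ D * q ^ D / q ^ M)"
      by (intro sum_mono pair)
    also have "\<dots> = \<mu> + \<mu>\<^sup>2 / q ^ M"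
      using fin(2) cN by (simp add: sum.distrib \<mu>_def power2_eq_square distrib_left mult_ac)
    finally show ?thesis .
  qed
  have "\<mu>\<^sup>2 * binweight p E {H. \<not> contains_isolated j V H} =
      (\<Sum>H\<in>Pow E. w H * (\<mu>\<^sup>2 * of_bool (\<not> contains_isolated j V H)))"
    using ex[of "{H. \<not> contains_isolated j V H}"] by (simp add: sum_distrib_left mult_ac flip: ex)
  \<comment> \<open>Without isolated \<open>j\<close>-sets \<open>X H = 0\<close>, so the deviation
    from the mean is \<open>\<mu>\<close>.\<close>
  also have "\<dots> \<le> (\<Sum>H\<in>Pow E. w H * (X H - \<mu>)\<^sup>2)"
  proof (intro sum_mono mult_left_mono w)
    fix H
    show "\<mu>\<^sup>2 * of_bool (\<not> contains_isolated j V H) \<le> (X H - \<mu>)\<^sup>2"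
    proof (cases "contains_isolated j V H")
      case False
      hence "X H = 0" by (simp add: X_def contains_isolated_def JS_def)
      thus ?thesis by simp
    qed simp
  qed
  also have "\<dots> = (\<Sum>H\<in>Pow E. w H * (X H)\<^sup>2 - 2 * \<mu> * (w H * X H) + \<mu>\<^sup>2 * w H)"
    by (intro sum.cong refl) (simp add: power2_diff algebra_simps)
  also have "\<dots> = (\<Sum>H\<in>Pow E. w H * (X H)\<^sup>2) - 2 * \<mu> * \<mu> + \<mu>\<^sup>2 * (\<Sum>H\<in>Pow E. w H)"
    by (simp add: sum.distrib sum_subtractf EX flip: sum_distrib_left)
  also have "(\<Sum>H\<in>Pow E. w H) = 1" using ex[of UNIV] fin by simp
  also have "(\<Sum>H\<in>Pow E. w H * (X H)\<^sup>2) - 2 * \<mu> * \<mu> + \<mu>\<^sup>2 * 1 \<le> \<mu> + \<mu>\<^sup>2 / q ^ M - \<mu>\<^sup>2"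
    using EX2 by (simp add: power2_eq_square)
  also have "\<dots> = \<mu>\<^sup>2 * (1 / \<mu> + 1 / q ^ M - 1)"
    using \<mu> by (simp add: power2_eq_square algebra_simps)
  finally have "binweight p E {H. \<not> contains_isolated j V H} \<le> 1 / \<mu> + 1 / q ^ M - 1"
    using \<mu> by simp
  thus ?thesis by (simp add: \<mu>_def q_def E_def)
qed

text \<open>If the component of \<open>J\<close> is small, either it is \<open>{J}\<close> and all
  edges through \<open>J\<close> are absent, or it is one of the sets controlled by
  \<open>\<beta>\<close>. The factor \<open>n choose j\<close> is the union bound over
  \<open>J\<close>.\<close>

lemma binweight_not_connected_le:
  assumes V: "finite V" "card V = n" and j: "1 \<le> j" "j < k" "1 < n choose j"
    and p: "0 \<le> p" "p \<le> 1" and q: "0 < q" "q < 1"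
    and \<beta>: "\<And>S. S \<subseteq> nsets V j \<Longrightarrow> 2 \<le> card S \<Longrightarrow> 2 * card S \<le> n choose j \<Longrightarrow>
      (1 / q) ^ card S * ((1 - p) / (1 - p * q)) ^ card (jboundary j (nsets V k) S) \<le> \<beta>"
    and "0 \<le> \<beta>"
  shows "binweight p (nsets V k) {H. \<not> hypergraph_j_connected j V H \<or> contains_isolated j V H}
    \<le> real (n choose j) * ((1 - p) ^ ((n - j) choose (k - j)) + \<beta>)"
proof -
  define E where "E = nsets V k"
  define JS where "JS = nsets V j"
  define \<S> where "\<S> = {S. S \<subseteq> JS \<and> 2 \<le> card S \<and> 2 * card S \<le> n choose j}"
  let ?C = "\<lambda>J S. {H. jcomp j H J = S}"
  let ?D = "(n - j) choose (k - j)"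
  have fin: "finite E" "finite JS" using V by (auto simp: E_def JS_def finite_imp_finite_nsets)
  have fin\<S>: "finite \<S>" unfolding \<S>_def using fin by simp
  have cN: "card JS = n choose j" using V by (simp add: JS_def)
  have pq: "0 \<le> p * q" "p * q \<le> 1" using p q mult_mono[of p 1 q 1] by auto
  have isolated: "binweight p E (?C J {J}) \<le> (1 - p) ^ ?D" if J: "J \<in> JS" for J
  proof -
    let ?F = "{e \<in> E. J \<subseteq> e}"
    have "?F \<subseteq> jboundary j E {J}"
    proof
      fix e assume e: "e \<in> ?F"
      hence "J \<in> nsets e j" "card e = k" using J by (auto simp: E_def JS_def nsets_def)
      moreover from this obtain J' where "J' \<in> nsets e j" "J' \<noteq> J"
        using exists_other_nset j by blast
      ultimately show "e \<in> jboundary j E {J}" using e unfolding jboundary_def by blast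
    qed
    hence "binweight p E (?C J {J}) \<le> binweight p E {H. H \<inter> ?F = {}}"
      using fin p jcomp_disjoint_boundary[of j _ J "{J}" E] by (intro binweight_mono) blast+
    also have "\<dots> = (1 - p) ^ card ?F" by (rule binweight_avoid) (use fin in auto)
    also have "card ?F = ?D"
      using card_nsets_superset[OF V(1), of J k] J j V by (auto simp: E_def JS_def nsets_def)
    finally show ?thesis .
  qed
  have larger: "binweight p E (\<Union>S\<in>\<S>. ?C J S) \<le> \<beta>" for J
  proof -
    have "binweight p E (\<Union>S\<in>\<S>. ?C J S) \<le> (\<Sum>S\<in>\<S>. binweight p E (?C J S))"
      using fin fin\<S> p by (intro binweight_UN_le)
    also have "\<dots> \<le> (\<Sum>S\<in>\<S>. \<beta> * binweight (p * q) E (?C J S))"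
    proof (rule sum_mono)
      fix S assume S: "S \<in> \<S>"
      hence "finite S" using fin finite_subset unfolding \<S>_def by blast
      hence "binweight p E (?C J S) \<le>
          (1 / q) ^ card S * ((1 - p) / (1 - p * q)) ^ card (jboundary j E S)
          * binweight (p * q) E (?C J S)"
        using fin p q by (intro binweight_jcomp_eq_le)
      also have "\<dots> \<le> \<beta> * binweight (p * q) E (?C J S)"
        using S \<beta>[of S] pq by (intro mult_right_mono binweight_nonneg) (auto simp: \<S>_def E_def JS_def)
      finally show "binweight p E (?C J S) \<le> \<beta> * binweight (p * q) E (?C J S)" .
    qed
    \<comment> \<open>For fixed \<open>J\<close> the component is unique, so the events for
      different \<open>S\<close> are disjoint; no count of the sets \<open>S\<close> enters.\<close>
    also have "\<dots> = \<beta> * binweight (p * q) E (\<Union>S\<in>\<S>. ?C J S)"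
      using fin fin\<S> by (subst binweight_UN_disjoint) (auto simp: disjoint_family_on_def sum_distrib_left)
    also have "\<dots> \<le> \<beta> * binweight (p * q) E UNIV"
      using fin pq \<open>0 \<le> \<beta>\<close> by (intro mult_left_mono binweight_mono) auto
    finally show ?thesis using fin by simp
  qed
  \<comment> \<open>The index \<open>b\<close> writes the two cases as one indexed union, to which
    \<open>binweight_UN_le\<close> applies.\<close>
  have "binweight p E {H. \<not> hypergraph_j_connected j V H \<or> contains_isolated j V H} \<le>
      binweight p E (\<Union>J\<in>JS. \<Union>b\<in>UNIV. if b then ?C J {J} else (\<Union>S\<in>\<S>. ?C J S))"
  proof (rule binweight_mono)
    fix H assume H: "H \<subseteq> E" "H \<in> {H. \<not> hypergraph_j_connected j V H \<or> contains_isolated j V H}"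
    obtain J where J: "J \<in> JS" "2 * card (jcomp j H J) \<le> n choose j"
      using small_jcomp_if_not_connected[OF V(1), of H k j] H j V unfolding E_def JS_def by auto
    have sub: "jcomp j H J \<subseteq> JS"
      using jcomp_subset_nsets[of H V k J j] H J by (simp add: E_def JS_def)
    have finc: "finite (jcomp j H J)" using sub fin finite_subset by blast
    have "jcomp j H J = {J} \<or> jcomp j H J \<in> \<S>"
    proof (cases "card (jcomp j H J) \<le> 1")
      case True
      thus ?thesis using jcomp_refl[of J j H] finc by (auto simp: card_le_Suc0_iff_eq)
    next
      case False
      thus ?thesis using sub J by (simp add: \<S>_def)
    qed
    thus "H \<in> (\<Union>J\<in>JS. \<Union>b\<in>UNIV. if b then ?C J {J} else (\<Union>S\<in>\<S>. ?C J S))"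
      using J by (auto simp: UNIV_bool)
  qed (use fin p in auto)
  also have "\<dots> \<le> (\<Sum>J\<in>JS. binweight p E (\<Union>b\<in>UNIV. if b then ?C J {J} else (\<Union>S\<in>\<S>. ?C J S)))"
    using fin p by (intro binweight_UN_le)
  also have "\<dots> \<le> (\<Sum>J\<in>JS. (1 - p) ^ ?D + \<beta>)"
  proof (rule sum_mono)
    fix J assume J: "J \<in> JS"
    have "binweight p E (\<Union>b\<in>UNIV. if b then ?C J {J} else (\<Union>S\<in>\<S>. ?C J S)) \<le>
        (\<Sum>b\<in>UNIV. binweight p E (if b then ?C J {J} else (\<Union>S\<in>\<S>. ?C J S)))"
      using fin p by (intro binweight_UN_le) auto
    also have "\<dots> = binweight p E (?C J {J}) + binweight p E (\<Union>S\<in>\<S>. ?C J S)"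
      by (simp add: UNIV_bool)
    also have "\<dots> \<le> (1 - p) ^ ?D + \<beta>" using isolated[OF J] larger[of J] by linarith
    finally show "binweight p E (\<Union>b\<in>UNIV. if b then ?C J {J} else (\<Union>S\<in>\<S>. ?C J S))
        \<le> (1 - p) ^ ?D + \<beta>" .
  qed
  finally show ?thesis by (simp add: E_def cN algebra_simps)
qed

subsection \<open>Asymptotics\<close>

text \<open>Pascal's rule is applied \<open>i\<close> times, and each application loses at most
  \<open>(n - 1) choose (m - 1)\<close>.\<close>

lemma choose_le_choose_diff_add:
  assumes "1 \<le> m"
  shows "n choose m \<le> ((n - i) choose m) + i * ((n - 1) choose (m - 1))"
proof (induction i)
  case (Suc i)
  have "(n - i) choose m \<le> ((n - Suc i) choose m) + ((n - 1) choose (m - 1))"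
  proof (cases "n - i")
    case (Suc a)
    obtain m' where m: "m = Suc m'" using assms by (cases m) auto
    have "a = n - Suc i" "a \<le> n - 1" using Suc by auto
    thus ?thesis using Suc m binomial_right_mono[of a "n - 1" m'] by simp
  qed (use assms in auto)
  thus ?case using Suc by simp
qed simp

lemma real_choose_minus_one:
  assumes "1 \<le> m" "1 \<le> n"
  shows "real ((n - 1) choose (m - 1)) = real m / real n * real (n choose m)"
proof -
  have "m * (n choose m) = n * ((n - 1) choose (m - 1))"
    using binomial_absorption[of "m - 1" n] assms by simp
  hence "real m * real (n choose m) = real n * real ((n - 1) choose (m - 1))"
    by (metis of_nat_mult)
  thus ?thesis using assms by (simp add: field_simps)
qed

lemma choose_diff_ge:
  assumes "1 \<le> m" "1 \<le> n"
  shows "real (n choose m) * (1 - real i * real m / real n) \<le> real ((n - i) choose m)"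
proof -
  have "real (n choose m) \<le> real (((n - i) choose m) + i * ((n - 1) choose (m - 1)))"
    using choose_le_choose_diff_add[OF assms(1)] by (simp only: of_nat_le_iff)
  also have "\<dots> = real ((n - i) choose m) + real i * (real m / real n * real (n choose m))"
    using real_choose_minus_one[OF assms] by simp
  finally show ?thesis by (simp add: algebra_simps)
qed

text \<open>A crude bound, enough to make both densities \<open>p\<close> at most of order
  \<open>ln n / n\<close>.\<close>

lemma choose_ge_linear:
  assumes "1 \<le> m" "m \<le> n"
  shows "real n / real m \<le> real (n choose m)"
proof -
  have "real n / real m \<le> (real n / real m) ^ m"
    using assms by (intro self_le_power) auto
  also have "\<dots> \<le> real (n choose m)" using assms by (intro binomial_ge_n_over_k_pow_k)
  finally show ?thesis .
qed

lemma choose_le_exp: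
  assumes "1 \<le> n" "j \<le> n"
  shows "real (n choose j) \<le> exp (real j * ln (real n))"
proof -
  have "real (n choose j) \<le> real n ^ j"
    using binomial_le_pow[OF assms(2)] by (metis of_nat_le_iff of_nat_power)
  thus ?thesis using assms by (simp add: exp_of_nat_mult)
qed

text \<open>Only distinct \<open>j\<close>-sets are compared, so a partner for the isolated one is
  needed, and \<open>j < card V\<close> provides it. The first edge of a connecting sequence would
  contain the isolated set.\<close>

lemma isolated_imp_not_connected:
  assumes "contains_isolated j V H" "1 \<le> j" "j < card V"
  shows "\<not> hypergraph_j_connected j V H"
proof -
  obtain J where J: "J \<in> nsets V j" "isolated_set H J"
    using assms by (auto simp: contains_isolated_def)
  then obtain J' where J': "J' \<in> nsets V j" "J' \<noteq> J" using exists_other_nset assms by blast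
  have "\<not> sets_j_connected j H J J'"
  proof
    assume "sets_j_connected j H J J'"
    then obtain es where es: "es \<noteq> []" "set es \<subseteq> H" "J \<subseteq> hd es" unfolding sets_j_connected_def by blast
    hence "hd es \<in> H" by auto
    thus False using es J by (auto simp: isolated_set_def)
  qed
  thus ?thesis using J J' unfolding hypergraph_j_connected_def by metis
qed

lemma tendsto_one_lower_bound:
  fixes f g :: "nat \<Rightarrow> real"
  assumes "eventually (\<lambda>n. 1 - g n \<le> f n) sequentially" "g \<longlonglongrightarrow> 0" "\<And>n. f n \<le> 1"
  shows "f \<longlonglongrightarrow> 1"
proof (rule tendsto_sandwich)
  show "(\<lambda>n. 1 - g n) \<longlonglongrightarrow> 1" using tendsto_diff[OF tendsto_const assms(2), of 1] by simp
qed (use assms in auto)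

text \<open>This supplies \<open>\<beta>\<close> for the retention probability
  \<open>q = 1 / 4\<close>: here 4 is \<open>1 / q\<close>, and \<open>exp (- (3 / 4) * p)\<close>
  bounds the ratio of \<open>1 - p\<close> to \<open>1 - p * q\<close>. Sets with at most
  \<open>s0\<close> members use \<open>jboundary_sparse\<close>, larger ones
  \<open>jboundary_expansion\<close>; both summands are \<open>o(n ^ (- j))\<close>.\<close>

lemma eventually_jboundary_exp_bound:
  assumes j: "1 \<le> j" "j < k"
  shows "\<exists>s0. eventually (\<lambda>n. \<forall>S p. S \<subseteq> nsets {1..n} j \<longrightarrow> 2 \<le> card S \<longrightarrow> 2 * card S \<le> n choose j \<longrightarrow>
      real j * ln (real n) / real (n choose (k - j)) \<le> p \<longrightarrow>
      4 ^ card S * exp (- (3 / 4) * p * real (card (jboundary j (nsets {1..n} k) S))) \<le>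
      16 * exp (- (4 / 3) * real j * ln (real n)) + 4 ^ s0 * exp (- 2 * real j * ln (real n)))
    sequentially"
proof -
  define m where "m = k - j"
  have m: "1 \<le> m" using j by (simp add: m_def)
  define K where "K = k choose j"
  have K: "1 \<le> K" using j by (simp add: K_def Suc_le_eq)
  \<comment> \<open>Chosen so that \<open>s0 / (8 * K) = 2 * j\<close>: with
    \<open>L = ln n\<close>, a product of \<open>s0\<close> factors
    \<open>exp (- L / (8 * K))\<close> is \<open>exp (- 2 * j * L)\<close>.\<close>
  define s0 where "s0 = 16 * K * j"
  \<comment> \<open>The value \<open>8 / 9\<close> gives each member of \<open>S\<close> the
    exponent \<open>(3 / 4) * (8 / 9) = 2 / 3\<close> times \<open>j * ln n\<close>. Two members
    give \<open>4 / 3\<close>, which exceeds 1; a single one would not suffice.\<close>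
  have ev: "eventually (\<lambda>n. 8 / 9 \<le> (1 - real j * real m / real n) * (1 - real s0 * real m / (real n - real j))) sequentially"
    "eventually (\<lambda>n. 1 / 2 \<le> 1 - real j * real m / real n) sequentially"
    "eventually (\<lambda>n. 3 / 4 \<le> 1 - real j * real j / real n) sequentially"
    by real_asymp+
  have "real j > 0" "real K > 0" using j K by auto
  hence ev2: "eventually (\<lambda>n. 4 * exp (- (2 / 3) * real j * ln (real n)) \<le> 1) sequentially"
    "eventually (\<lambda>n. 4 * exp (- (1 / (8 * real K)) * ln (real n)) \<le> 1) sequentially"
    by real_asymp+
  show ?thesis
  proof (intro exI)
    show "eventually (\<lambda>n. \<forall>S p. S \<subseteq> nsets {1..n} j \<longrightarrow> 2 \<le> card S \<longrightarrow> 2 * card S \<le> n choose j \<longrightarrow>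
      real j * ln (real n) / real (n choose (k - j)) \<le> p \<longrightarrow>
      4 ^ card S * exp (- (3 / 4) * p * real (card (jboundary j (nsets {1..n} k) S))) \<le>
      16 * exp (- (4 / 3) * real j * ln (real n)) + 4 ^ s0 * exp (- 2 * real j * ln (real n)))
      sequentially"
      using ev ev2 eventually_gt_at_top[of "2 * j + k"]
    proof eventually_elim
      case (elim n)
      show ?case
      proof (intro allI impI)
        fix S p assume S: "S \<subseteq> nsets {1..n} j" and s2: "2 \<le> card S" "2 * card S \<le> n choose j"
          and p: "real j * ln (real n) / real (n choose (k - j)) \<le> p"
        define L where "L = ln (real n)"
        define C where "C = real (n choose m)"
        define D where "D = real ((n - j) choose m)"
        define M where "M = real ((n - j - 1) choose (m - 1))"
        define s where "s = card S"
        define b where "b = real (card (jboundary j (nsets {1..n} k) S))"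
        have n: "2 * j \<le> n" "j < n" "m \<le> n" "1 \<le> n" "k \<le> n" using elim(6) by (auto simp: m_def)
        have L: "L \<ge> 0" using n by (simp add: L_def)
        have C: "C > 0" using n by (simp add: C_def)
        have pC: "real j * L \<le> p * C" using p C by (simp add: pos_divide_le_eq C_def L_def m_def)
        have p0: "p \<ge> 0" using order_trans[OF _ p, of 0] n by simp
        have DC: "C * (1 - real j * real m / real n) \<le> D"
          unfolding C_def D_def using choose_diff_ge[OF m, of n j] n by simp
        have pD: "real j * L * (1 - real j * real m / real n) \<le> p * D"
        proof -
          have "real j * L * (1 - real j * real m / real n) \<le> p * C * (1 - real j * real m / real n)"
            using pC elim(2) by (intro mult_right_mono) linarith+
          also have "\<dots> = p * (C * (1 - real j * real m / real n))" by simp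
          also have "\<dots> \<le> p * D" using DC p0 by (intro mult_left_mono)
          finally show ?thesis .
        qed
        show "4 ^ card S * exp (- (3 / 4) * p * real (card (jboundary j (nsets {1..n} k) S))) \<le>
            16 * exp (- (4 / 3) * real j * ln (real n)) + 4 ^ s0 * exp (- 2 * real j * ln (real n))"
        proof (cases "s \<le> s0")
          case True
          have Mm: "M = real m / (real n - real j) * D"
            unfolding M_def D_def using real_choose_minus_one[OF m, of "n - j"] n
            by simp
          have "real (card S * ((n - j) choose (k - j))) \<le>
              real (card (jboundary j (nsets {1..n} k) S)
              + card S * card S * ((n - j - 1) choose (k - j - 1)))"
            using jboundary_sparse[of "{1..n}" n j k S] S j by (simp only: of_nat_le_iff) simp
          hence "real s * D \<le> b + real s * real s * M"
            by (simp add: s_def D_def b_def M_def m_def)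
          also have "\<dots> \<le> b + real s * real s0 * M"
            using True by (intro add_left_mono mult_right_mono mult_left_mono) (auto simp: M_def)
          finally have "real s * (D * (1 - real s0 * real m / (real n - real j))) \<le> b"
            unfolding Mm by (simp add: algebra_simps)
          hence "p * (real s * (D * (1 - real s0 * real m / (real n - real j)))) \<le> p * b"
            using p0 by (intro mult_left_mono)
          moreover have "real s * (real j * L * (8 / 9)) \<le>
              p * (real s * (D * (1 - real s0 * real m / (real n - real j))))"
          proof -
            have nn: "0 \<le> 1 - real s0 * real m / (real n - real j)"
              using elim(1,2) by (smt (verit) mult_pos_neg divide_pos_pos)
            have "real j * L * (8 / 9) \<le> real j * L *
                ((1 - real j * real m / real n) * (1 - real s0 * real m / (real n - real j)))"
              using elim(1) L by (intro mult_left_mono) auto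
            also have "\<dots> = real j * L * (1 - real j * real m / real n)
                * (1 - real s0 * real m / (real n - real j))" by simp
            also have "\<dots> \<le> p * D * (1 - real s0 * real m / (real n - real j))"
              using pD nn by (rule mult_right_mono)
            finally have "real s * (real j * L * (8 / 9)) \<le>
                real s * (p * D * (1 - real s0 * real m / (real n - real j)))"
              by (intro mult_left_mono) auto
            thus ?thesis by (simp only: mult_ac)
          qed
          ultimately have "real s * (real j * L * (8 / 9)) \<le> p * b" by linarith
          hence "exp (- (3 / 4) * p * b) \<le> exp (real s * (- (2 / 3) * real j * L))"
            by (simp only: exp_le_cancel_iff)
          hence "4 ^ s * exp (- (3 / 4) * p * b) \<le> 4 ^ s * exp (- (2 / 3) * real j * L) ^ s"
            unfolding exp_of_nat_mult by (rule mult_left_mono) simp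
          also have "\<dots> = (4 * exp (- (2 / 3) * real j * L)) ^ s" by (simp add: power_mult_distrib)
          \<comment> \<open>The base is at most 1, so the power is largest at the smallest size,
            2.\<close>
          also have "\<dots> \<le> (4 * exp (- (2 / 3) * real j * L)) ^ 2"
            using elim(4) s2 by (intro power_decreasing) (auto simp: L_def s_def)
          also have "\<dots> = 16 * exp (- (4 / 3) * real j * L)"
            by (simp add: power_mult_distrib flip: exp_of_nat_mult)
          also have "\<dots> \<le> 16 * exp (- (4 / 3) * real j * L) + 4 ^ s0 * exp (- 2 * real j * L)"
            by simp
          finally show ?thesis by (simp only: s_def b_def L_def)
        next
          case False
          \<comment> \<open>Since \<open>(n - j) choose j\<close> is at least three quarters of
            \<open>n choose j\<close>, half of all \<open>j\<close>-sets is at most two thirds of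
            it, as \<open>jboundary_expansion\<close> demands.\<close>
          have "real (n choose j) * (3 / 4) \<le> real (n choose j) * (1 - real j * real j / real n)"
            using elim(3) by (intro mult_left_mono) auto
          also have "\<dots> \<le> real ((n - j) choose j)" using choose_diff_ge[of j n j] j n by simp
          finally have "3 * (n choose j) \<le> 4 * ((n - j) choose j)" by linarith
          hence "3 * card S \<le> 2 * ((n - j) choose j)" using s2 by linarith
          hence "card S * ((n - j) choose (k - j)) \<le>
              3 * j * (k choose j) * card (jboundary j (nsets {1..n} k) S)"
            using jboundary_expansion[of "{1..n}" n j k S] S j n by simp
          hence "real (card S * ((n - j) choose (k - j))) \<le>
              real (3 * j * (k choose j) * card (jboundary j (nsets {1..n} k) S))"
            by (simp only: of_nat_le_iff)
          hence sD: "real s * D \<le> 3 * real j * real K * b"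
            by (simp add: s_def D_def b_def m_def K_def)
          \<comment> \<open>From \<open>p * D \<ge> j * L / 2\<close> and the expansion factor
            \<open>3 * j * K\<close> comes \<open>p * b \<ge> s * L / (6 * K)\<close>; three
            quarters of this is \<open>s * L / (8 * K)\<close>.\<close>
          have "real s * (real j * L * (1 / 2)) \<le> real s * (p * D)"
          proof (intro mult_left_mono)
            have "real j * L * (1 / 2) \<le> real j * L * (1 - real j * real m / real n)"
              using elim(2) L by (intro mult_left_mono) auto
            thus "real j * L * (1 / 2) \<le> p * D" using pD by linarith
          qed simp
          also have "\<dots> = p * (real s * D)" by simp
          also have "\<dots> \<le> p * (3 * real j * real K * b)" using sD p0 by (intro mult_left_mono)
          finally have "real j * (real s * L) \<le> real j * (6 * real K * (p * b))"
            by (simp add: algebra_simps)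
          hence "real s * L \<le> 6 * real K * (p * b)" using j by simp
          hence "real s * (1 / (8 * real K) * L) \<le> 3 / 4 * p * b"
            using K by (simp add: field_simps)
          hence "exp (- (3 / 4) * p * b) \<le> exp (real s * (- (1 / (8 * real K)) * L))"
            by (simp only: exp_le_cancel_iff)
          hence "4 ^ s * exp (- (3 / 4) * p * b) \<le> 4 ^ s * exp (- (1 / (8 * real K)) * L) ^ s"
            unfolding exp_of_nat_mult by (rule mult_left_mono) simp
          also have "\<dots> = (4 * exp (- (1 / (8 * real K)) * L)) ^ s" by (simp add: power_mult_distrib)
          also have "\<dots> \<le> (4 * exp (- (1 / (8 * real K)) * L)) ^ s0"
            using elim(5) False by (intro power_decreasing) (auto simp: L_def)
          also have "\<dots> = 4 ^ s0 * exp (real s0 * (- (1 / (8 * real K)) * L))"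
            by (simp only: power_mult_distrib exp_of_nat_mult)
          also have "real s0 * (- (1 / (8 * real K)) * L) = - 2 * real j * L"
            using K by (simp add: s0_def)
          also have "4 ^ s0 * exp (- 2 * real j * L) \<le>
              16 * exp (- (4 / 3) * real j * L) + 4 ^ s0 * exp (- 2 * real j * L)"
            by simp
          finally show ?thesis by (simp only: s_def b_def L_def)
        qed
      qed
    qed
  qed
qed

section \<open>Convergence at the two densities\<close>

context
  fixes k j :: nat and \<omega> :: "nat \<Rightarrow> real"
  assumes j: "1 \<le> j" "j < k" and \<omega>_pos: "\<And>n. \<omega> n > 0"
    and \<omega>_top: "filterlim \<omega> at_top sequentially"
    and \<omega>_small: "\<omega> \<in> o[sequentially](\<lambda>n. ln (real n))"
begin

text \<open>This keeps the density of part (i) nonnegative and bounds the numerator in part (ii) by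
  \<open>(j + 1) * ln n\<close>.\<close>

lemma \<omega>_le_ln: "eventually (\<lambda>n. \<omega> n \<le> ln (real n)) sequentially"
proof -
  have "eventually (\<lambda>n. norm (\<omega> n) \<le> 1 * norm (ln (real n))) sequentially"
    using landau_o.smallD[OF \<omega>_small, of 1] by simp
  moreover have "eventually (\<lambda>n. 1 \<le> n) sequentially" by (rule eventually_ge_at_top)
  ultimately show ?thesis
  proof eventually_elim
    case (elim n)
    thus ?case using \<omega>_pos[of n] by simp
  qed
qed

text \<open>The 1 in the exponent absorbs the bounded error in the estimates of
  \<open>(1 - p) ^ D\<close> in both parts.\<close>

lemma exp_minus_\<omega>_tendsto: "(\<lambda>n. c * exp (1 - \<omega> n)) \<longlonglongrightarrow> 0"
proof -
  have "filterlim (\<lambda>n. - \<omega> n) at_bot sequentially"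
    using \<omega>_top by (simp add: filterlim_uminus_at_top)
  hence "filterlim (\<lambda>n. 1 - \<omega> n) at_bot sequentially"
    using filterlim_tendsto_add_at_bot_iff[OF tendsto_const[of 1], of "\<lambda>n. - \<omega> n" sequentially] by simp
  hence "(\<lambda>n. exp (1 - \<omega> n)) \<longlonglongrightarrow> 0" by (rule filterlim_compose[OF exp_at_bot])
  thus ?thesis by (rule tendsto_mult_right_zero)
qed

text \<open>For large \<open>n\<close> the mean number of isolated \<open>j\<close>-sets is at least
  \<open>exp (\<omega> n - 1) / j ^ j\<close>, while \<open>M * p \<le> \<delta> n\<close> makes the
  contribution of the codegrees vanish. The two summands of \<open>err\<close> record these two
  effects.\<close>

lemma isolated_whp:
  "(\<lambda>n. measure_pmf.prob
      (random_hypergraph k n ((real j * ln (real n) - \<omega> n) / real (n choose (k - j))))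
      {H. contains_isolated j {1..n} H \<and> \<not> hypergraph_j_connected j {1..n} H}) \<longlonglongrightarrow> 1"
proof -
  define m where "m = k - j"
  have m: "1 \<le> m" using j by (simp add: m_def)
  define \<delta> where "\<delta> n = real m * real j * ln (real n) / (real n - real j)" for n
  define err where "err n = real j ^ j * exp (1 - \<omega> n) + (1 / (1 - \<delta> n) - 1)" for n
  have \<delta>0: "\<delta> \<longlonglongrightarrow> 0" unfolding \<delta>_def by real_asymp
  have "(\<lambda>n. 1 / (1 - \<delta> n) - 1) \<longlonglongrightarrow> 1 / (1 - 0) - 1"
    by (intro tendsto_intros \<delta>0) simp
  hence err0: "err \<longlonglongrightarrow> 0"
    unfolding err_def using tendsto_add[OF exp_minus_\<omega>_tendsto[of "real j ^ j"]] by simp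
  have ev: "eventually (\<lambda>n. real j * real m * ln (real n) / real n \<le> 1 / 2) sequentially"
    "eventually (\<lambda>n. 2 * (real j * real m * ln (real n) / real n) * (real j * ln (real n)) \<le> 1) sequentially"
    by real_asymp+
  have ev\<delta>: "eventually (\<lambda>n. \<delta> n < 1) sequentially" using \<delta>0 by (rule order_tendstoD) simp
  show ?thesis
  proof (rule tendsto_one_lower_bound[where g = err])
    show "eventually (\<lambda>n. 1 - err n \<le> measure_pmf.prob
      (random_hypergraph k n ((real j * ln (real n) - \<omega> n) / real (n choose (k - j))))
      {H. contains_isolated j {1..n} H \<and> \<not> hypergraph_j_connected j {1..n} H}) sequentially"
      using \<omega>_le_ln ev ev\<delta> eventually_gt_at_top[of "j + k"]
    proof eventually_elim
      case (elim n)
      define L where "L = ln (real n)"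
      define C where "C = real (n choose m)"
      define p where "p = (real j * L - \<omega> n) / C"
      define D where "D = (n - j) choose m"
      define M where "M = (n - j - 1) choose (m - 1)"
      define N where "N = n choose j"
      have n: "j < n" "m \<le> n" "1 \<le> n" "k \<le> n" using elim(5) by (auto simp: m_def)
      have C: "C > 0" "real n / real m \<le> C"
        using n m choose_ge_linear[OF m] by (auto simp: C_def)
      have L: "L \<ge> 0" using n by (simp add: L_def)
      have "1 * L \<le> real j * L" using j L by (intro mult_right_mono) auto
      hence \<omega>: "\<omega> n \<le> real j * L" "0 < \<omega> n"
        using elim(1) \<omega>_pos[of n] unfolding L_def by linarith+
      have p0: "0 \<le> p" using \<omega> C by (simp add: p_def)
      have pC: "p * C = real j * L - \<omega> n" using C by (simp add: p_def)
      have "p \<le> real j * L / C" using C \<omega> by (simp add: p_def divide_right_mono)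
      also have "\<dots> \<le> real j * L / (real n / real m)"
        using C L n m by (intro divide_left_mono) auto
      finally have pn: "p \<le> real j * real m * L / real n" using m by (simp add: field_simps)
      hence p1: "p \<le> 1 / 2" using elim(2) unfolding L_def by linarith
      have DC: "real D \<le> C"
        unfolding D_def C_def by (simp add: binomial_right_mono)
      have "p * real D \<le> real j * L - \<omega> n"
        using mult_left_mono[OF DC p0] pC by simp
      \<comment> \<open>The second-order term in \<open>ln (1 - p) \<ge> - p - 2 * p ^ 2\<close>
        costs at most 1 in the exponent.\<close>
      moreover have "2 * p\<^sup>2 * real D \<le> 1"
      proof -
        have "2 * p\<^sup>2 * real D = 2 * p * (p * real D)" by (simp add: power2_eq_square)
        also have "\<dots> \<le> 2 * p * (real j * L)"
          using \<open>p * real D \<le> real j * L - \<omega> n\<close> \<omega> p0 by (intro mult_left_mono) auto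
        also have "\<dots> \<le> 2 * (real j * real m * L / real n) * (real j * L)"
          using pn L by (intro mult_right_mono) auto
        also have "\<dots> \<le> 1" using elim(3) by (simp add: L_def)
        finally show ?thesis .
      qed
      ultimately have low: "\<omega> n - 1 - real j * L \<le> real D * (- p - 2 * p\<^sup>2)"
        by (simp add: algebra_simps)
      have "real D * (- p - 2 * p\<^sup>2) \<le> real D * ln (1 - p)"
        using p0 p1 by (intro mult_left_mono ln_one_minus_pos_lower_bound) auto
      hence "exp (\<omega> n - 1 - real j * L) \<le> exp (real D * ln (1 - p))" using low by simp
      also have "\<dots> = (1 - p) ^ D" using p1 by (simp add: exp_of_nat_mult)
      finally have qD: "exp (\<omega> n - 1 - real j * L) \<le> (1 - p) ^ D" .
      have "exp (real j * L) / real j ^ j = (real n / real j) ^ j"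
        using n by (simp add: exp_of_nat_mult L_def power_divide)
      also have "\<dots> \<le> real N" unfolding N_def using n by (intro binomial_ge_n_over_k_pow_k) auto
      finally have NN: "exp (real j * L) / real j ^ j \<le> real N" .
      have "exp (real j * L) / real j ^ j * exp (\<omega> n - 1 - real j * L) \<le> real N * (1 - p) ^ D"
        using NN qD by (intro mult_mono) auto
      also have "exp (real j * L) / real j ^ j * exp (\<omega> n - 1 - real j * L) =
          exp (\<omega> n - 1) / real j ^ j"
        by (simp flip: exp_add)
      finally have "exp (\<omega> n - 1) / real j ^ j \<le> real N * (1 - p) ^ D" .
      hence "1 / (real N * (1 - p) ^ D) \<le> 1 / (exp (\<omega> n - 1) / real j ^ j)"
        using j n p1 by (intro divide_left_mono) (auto simp: N_def)
      also have "\<dots> = real j ^ j * exp (1 - \<omega> n)"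
        by (simp add: exp_diff)
      finally have e1: "1 / (real N * (1 - p) ^ D) \<le> real j ^ j * exp (1 - \<omega> n)" .
      have "real M * p \<le> \<delta> n"
      proof -
        have "real M = real m / real (n - j) * real D"
          unfolding M_def D_def using real_choose_minus_one[OF m, of "n - j"] n by simp
        hence "real M * p = real m / real (n - j) * (p * real D)" by simp
        also have "\<dots> \<le> real m / real (n - j) * (real j * L)"
          using \<open>p * real D \<le> real j * L - \<omega> n\<close> \<omega> by (intro mult_left_mono) auto
        also have "\<dots> = \<delta> n" using n by (simp add: \<delta>_def L_def)
        finally show ?thesis .
      qed
      moreover have "1 + real M * (- p) \<le> (1 + (- p)) ^ M"
        using p1 by (intro Bernoulli_inequality) simp
      ultimately have "1 - \<delta> n \<le> (1 - p) ^ M" by simp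
      hence e2: "1 / (1 - p) ^ M \<le> 1 / (1 - \<delta> n)"
        using elim(4) by (intro divide_left_mono) (auto intro!: mult_pos_pos zero_less_power simp: p1
            intro: order_less_le_trans)
      have "binweight p (nsets {1..n} k) {H. \<not> contains_isolated j {1..n} H} \<le>
          1 / (real N * (1 - p) ^ D) + 1 / (1 - p) ^ M - 1"
        using binweight_no_isolated_le[of "{1..n}" n j k p] j n p0 p1
        by (simp add: N_def D_def M_def m_def)
      also have "\<dots> \<le> err n" unfolding err_def using e1 e2 by simp
      finally have "1 - err n \<le> 1 - binweight p (nsets {1..n} k) {H. \<not> contains_isolated j {1..n} H}"
        by simp
      also have "\<dots> = binweight p (nsets {1..n} k) (- {H. \<not> contains_isolated j {1..n} H})"
        by (rule binweight_Compl[symmetric]) (simp add: finite_imp_finite_nsets)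
      also have "- {H. \<not> contains_isolated j {1..n} H} =
          {H. contains_isolated j {1..n} H \<and> \<not> hypergraph_j_connected j {1..n} H}"
        using isolated_imp_not_connected[of j "{1..n}"] j n by auto
      also have "binweight p (nsets {1..n} k) \<dots> = measure_pmf.prob (random_hypergraph k n p) \<dots>"
        using p0 p1 by (intro prob_random_hypergraph[symmetric]) auto
      finally show ?case by (simp add: p_def L_def C_def m_def)
    qed
  qed (use err0 in auto)
qed

text \<open>Singleton components contribute at most \<open>exp (1 - \<omega> n)\<close>, since there
  are at most \<open>n ^ j\<close> \<open>j\<close>-sets; larger ones contribute at most
  \<open>n ^ j * \<beta> n\<close>, which tends to 0.\<close>

lemma connected_whp:
  "(\<lambda>n. measure_pmf.prob
      (random_hypergraph k n ((real j * ln (real n) + \<omega> n) / real (n choose (k - j))))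
      {H. hypergraph_j_connected j {1..n} H \<and> \<not> contains_isolated j {1..n} H}) \<longlonglongrightarrow> 1"
proof -
  define m where "m = k - j"
  have m: "1 \<le> m" using j by (simp add: m_def)
  define c where "c = real j"
  have c: "c > 0" using j by (simp add: c_def)
  obtain s0 where s0: "eventually (\<lambda>n. \<forall>S p. S \<subseteq> nsets {1..n} j \<longrightarrow> 2 \<le> card S \<longrightarrow>
      2 * card S \<le> n choose j \<longrightarrow> real j * ln (real n) / real (n choose (k - j)) \<le> p \<longrightarrow>
      4 ^ card S * exp (- (3 / 4) * p * real (card (jboundary j (nsets {1..n} k) S))) \<le>
      16 * exp (- (4 / 3) * real j * ln (real n)) + 4 ^ s0 * exp (- 2 * real j * ln (real n)))
    sequentially"
    using eventually_jboundary_exp_bound[OF j] by blast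
  define \<beta> where "\<beta> n = 16 * exp (- (4 / 3) * c * ln (real n)) + 4 ^ s0 * exp (- 2 * c * ln (real n))"
    for n
  define err where "err n = 1 * exp (1 - \<omega> n) + exp (c * ln (real n)) * \<beta> n" for n
  have "(\<lambda>n. exp (c * ln (real n)) * \<beta> n) \<longlonglongrightarrow> 0" unfolding \<beta>_def using c by real_asymp
  hence err0: "err \<longlonglongrightarrow> 0"
    unfolding err_def using tendsto_add[OF exp_minus_\<omega>_tendsto[of 1]] by simp
  have ev: "eventually (\<lambda>n. (real j + 1) * real m * ln (real n) / real n \<le> 1) sequentially"
    "eventually (\<lambda>n. (real j + 1) * ln (real n) * (real j * real m / real n) \<le> 1) sequentially"
    by real_asymp+
  show ?thesis
  proof (rule tendsto_one_lower_bound[where g = err])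
    show "eventually (\<lambda>n. 1 - err n \<le> measure_pmf.prob
      (random_hypergraph k n ((real j * ln (real n) + \<omega> n) / real (n choose (k - j))))
      {H. hypergraph_j_connected j {1..n} H \<and> \<not> contains_isolated j {1..n} H}) sequentially"
      using \<omega>_le_ln ev s0 eventually_gt_at_top[of "j + k"]
    proof eventually_elim
      case (elim n)
      define L where "L = ln (real n)"
      define C where "C = real (n choose m)"
      define p where "p = (real j * L + \<omega> n) / C"
      define D where "D = (n - j) choose m"
      define N where "N = n choose j"
      let ?bad = "{H. \<not> hypergraph_j_connected j {1..n} H \<or> contains_isolated j {1..n} H}"
      have n: "j < n" "m \<le> n" "1 \<le> n" "k \<le> n" using elim(5) by (auto simp: m_def)
      have C: "C > 0" "real n / real m \<le> C"
        using n m choose_ge_linear[OF m] by (auto simp: C_def)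
      have L: "L \<ge> 0" using n by (simp add: L_def)
      have \<omega>: "\<omega> n \<le> L" "0 < \<omega> n" using elim(1) \<omega>_pos[of n] by (auto simp: L_def)
      have p0: "0 \<le> p" using \<omega> C L by (simp add: p_def)
      have pC: "p * C = real j * L + \<omega> n" using C by (simp add: p_def)
      have "p \<le> (real j + 1) * L / C"
        using C \<omega> by (simp add: p_def divide_right_mono algebra_simps)
      also have "\<dots> \<le> (real j + 1) * L / (real n / real m)"
        using C L n m by (intro divide_left_mono) auto
      also have "\<dots> = (real j + 1) * real m * ln (real n) / real n" by (simp add: L_def)
      finally have p1: "p \<le> 1" using elim(2) by linarith
      have DC: "C * (1 - real j * real m / real n) \<le> real D"
        unfolding C_def D_def using choose_diff_ge[OF m, of n j] n by simp
      have "(real j * L + \<omega> n) * (1 - real j * real m / real n) \<le> p * real D"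
        using mult_left_mono[OF DC p0] pC by (simp flip: mult.assoc)
      \<comment> \<open>Replacing \<open>C\<close> by the true degree \<open>D\<close> changes the
        exponent by at most 1.\<close>
      moreover have "(real j * L + \<omega> n) * (real j * real m / real n) \<le> 1"
      proof -
        have "(real j * L + \<omega> n) * (real j * real m / real n) \<le>
            (real j + 1) * L * (real j * real m / real n)"
          using \<omega> by (intro mult_right_mono) (auto simp: algebra_simps)
        thus ?thesis using elim(3) unfolding L_def by linarith
      qed
      ultimately have pD: "real j * L + \<omega> n - 1 \<le> p * real D" by (simp add: algebra_simps)
      have "(1 - p) ^ D \<le> exp (- p) ^ D"
        using p1 exp_ge_add_one_self[of "- p"] by (intro power_mono) auto
      also have "\<dots> = exp (- (p * real D))" by (simp flip: exp_of_nat2_mult)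
      also have "\<dots> \<le> exp (1 - \<omega> n - real j * L)" using pD by simp
      finally have qD: "(1 - p) ^ D \<le> exp (1 - \<omega> n - real j * L)" .
      have N: "real N \<le> exp (real j * L)"
        unfolding N_def L_def using n by (intro choose_le_exp) auto
      have "1 < N"
      proof -
        have "{1..j} \<in> nsets {1..n} j" using n by (auto simp: nsets_def)
        then obtain J' where J': "J' \<in> nsets {1..n} j" "J' \<noteq> {1..j}"
          using exists_other_nset[of "{1..j}" "{1..n}" j] j n by auto
        have "card {{1..j}, J'} \<le> card (nsets {1..n} j)"
          using J' \<open>{1..j} \<in> nsets {1..n} j\<close> by (intro card_mono finite_imp_finite_nsets) auto
        thus ?thesis using J' by (simp add: N_def)
      qed
      have ratio: "(1 - p) / (1 - p * (1 / 4)) \<le> exp (- (3 / 4) * p)"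
      proof -
        \<comment> \<open>The right side exceeds \<open>1 - p\<close> by
          \<open>3 / 16 * p ^ 2\<close>.\<close>
        have "1 - p \<le> (1 - 3 / 4 * p) * (1 - p * (1 / 4))"
          using p0 by (simp add: algebra_simps)
        hence "(1 - p) / (1 - p * (1 / 4)) \<le> 1 - 3 / 4 * p" using p1 by (simp add: pos_divide_le_eq)
        also have "\<dots> \<le> exp (- (3 / 4) * p)" using exp_ge_add_one_self[of "- (3 / 4) * p"] by simp
        finally show ?thesis .
      qed
      have bound: "(1 / (1 / 4)) ^ card S *
          ((1 - p) / (1 - p * (1 / 4))) ^ card (jboundary j (nsets {1..n} k) S) \<le> \<beta> n"
        if S: "S \<subseteq> nsets {1..n} j" "2 \<le> card S" "2 * card S \<le> n choose j" for S
      proof -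
        let ?b = "card (jboundary j (nsets {1..n} k) S)"
        have "((1 - p) / (1 - p * (1 / 4))) ^ ?b \<le> exp (- (3 / 4) * p) ^ ?b"
          using ratio p1 by (intro power_mono) auto
        also have "\<dots> = exp (- (3 / 4) * p * real ?b)" by (simp flip: exp_of_nat2_mult)
        finally have "4 ^ card S * ((1 - p) / (1 - p * (1 / 4))) ^ ?b \<le>
            4 ^ card S * exp (- (3 / 4) * p * real ?b)"
          by (intro mult_left_mono) auto
        also have "real j * ln (real n) / real (n choose (k - j)) \<le> p"
          using C \<omega> unfolding p_def L_def C_def m_def by (intro divide_right_mono) auto
        hence "4 ^ card S * exp (- (3 / 4) * p * real ?b) \<le> \<beta> n"
          unfolding \<beta>_def c_def using elim(4) S by blast
        finally show ?thesis by simp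
      qed
      have \<beta>0: "0 \<le> \<beta> n" unfolding \<beta>_def by simp
      have "binweight p (nsets {1..n} k) ?bad \<le> real N * ((1 - p) ^ D + \<beta> n)"
        using binweight_not_connected_le[of "{1..n}" n j k p "1 / 4" "\<beta> n"] bound \<beta>0 j p0 p1 \<open>1 < N\<close>
        by (simp add: N_def D_def m_def)
      also have "\<dots> \<le> exp (real j * L) * (exp (1 - \<omega> n - real j * L) + \<beta> n)"
        using N qD \<beta>0 p1 by (intro mult_mono add_right_mono) auto
      also have "\<dots> = err n"
        by (simp add: err_def c_def L_def distrib_left flip: exp_add)
      finally have "1 - err n \<le> 1 - binweight p (nsets {1..n} k) ?bad" by simp
      also have "\<dots> = binweight p (nsets {1..n} k) (- ?bad)"
        by (rule binweight_Compl[symmetric]) (simp add: finite_imp_finite_nsets)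
      also have "- ?bad = {H. hypergraph_j_connected j {1..n} H \<and> \<not> contains_isolated j {1..n} H}"
        by auto
      also have "binweight p (nsets {1..n} k) \<dots> = measure_pmf.prob (random_hypergraph k n p) \<dots>"
        using p0 p1 by (intro prob_random_hypergraph[symmetric]) auto
      finally show ?case by (simp add: p_def L_def C_def m_def)
    qed
  qed (use err0 in auto)
qed

end

theorem theorem6:
  fixes k j :: nat and \<omega> :: "nat \<Rightarrow> real"
  assumes "k \<ge> 3" and "1 \<le> j" and "j \<le> k - 1"
    and "\<And>n. \<omega> n > 0"
    and "filterlim \<omega> at_top sequentially"
    and "\<omega> \<in> o[sequentially](\<lambda>n. ln (real n))"
  shows "((\<lambda>n. measure_pmf.prob
            (random_hypergraph k n ((real j * ln (real n) - \<omega> n) / real (n choose (k - j))))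
            {H. contains_isolated j {1..n} H \<and> \<not> hypergraph_j_connected j {1..n} H})
          \<longlonglongrightarrow> 1) \<and>
         ((\<lambda>n. measure_pmf.prob
            (random_hypergraph k n ((real j * ln (real n) + \<omega> n) / real (n choose (k - j))))
            {H. hypergraph_j_connected j {1..n} H \<and> \<not> contains_isolated j {1..n} H})
          \<longlonglongrightarrow> 1)"
proof -
  have "j < k" using assms(1,3) by simp
  thus ?thesis using isolated_whp[OF assms(2) _ assms(4-6)] connected_whp[OF assms(2) _ assms(4-6)]
    by blast
qed

end
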